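(* $H_6(2)=24$.
   Context: An ordered real $m$-alphabet is a strictly increasing tuple $T=(t_0<\cdots<t_{m-1})$ of real numbers. For an integer $q\ge1$, an order-preserving integer $q$-model of $T$ is a strictly increasing tuple of integers $S=(s_0<\cdots<s_{m-1})$ such that for every $1\le h\le q$ and all index lists $i_1,\dots,i_h$, $j_1,\dots,j_h$ (repetitions allowed), $\sum_{\nu=1}^h t_{i_\nu}=\sum_{\nu=1}^h t_{j_\nu}$ if and only if $\sum_{\nu=1}^h s_{i_\nu}=\sum_{\nu=1}^h s_{j_\nu}$. The diameter of $S$ is $s_{m-1}-s_0$. $H_m(q)$ denotes the least integer $D$ such that every ordered real $m$-alphabet has an order-preserving integer $q$-model of diameter at most $D$. *)

theory Defs
  imports Complex_Main
begin

definition ordered_alphabet :: "nat \<Rightarrow> real list \<Rightarrow> bool" where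
  "ordered_alphabet m T \<longleftrightarrow> length T = m \<and> sorted_wrt (<) T"

definition order_preserving_model :: "nat \<Rightarrow> real list \<Rightarrow> int list \<Rightarrow> bool" where
  "order_preserving_model q T S \<longleftrightarrow>
     length S = length T \<and> sorted_wrt (<) S \<and>
     (\<forall>h is js. 1 \<le> h \<and> h \<le> q \<and> length is = h \<and> length js = h \<and>
        set is \<subseteq> {..<length T} \<and> set js \<subseteq> {..<length T} \<longrightarrow>
        ((\<Sum>i\<leftarrow>is. T ! i) = (\<Sum>j\<leftarrow>js. T ! j) \<longleftrightarrow>
         (\<Sum>i\<leftarrow>is. S ! i) = (\<Sum>j\<leftarrow>js. S ! j)))"

(* Only meaningful for nonempty lists. *)
definition diameter :: "int list \<Rightarrow> int" where
  "diameter S = last S - hd S"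

(* Only meaningful for m, q \<ge> 1, where every admissible D is nonnegative. *)
definition H :: "nat \<Rightarrow> nat \<Rightarrow> int" where
  "H m q = (LEAST D :: int. \<forall>T. ordered_alphabet m T \<longrightarrow>
     (\<exists>S. order_preserving_model q T S \<and> diameter S \<le> D))"

end

theory Submission
  imports Defs
begin

text \<open>
  In terms of the five gaps of a six-letter alphabet, a nontrivial equality between two-letter sums
  is one of 35 linear relations with coefficients in \<open>{-1, 0, 1}\<close>, so an alphabet
  is determined up to order-preserving isomorphism by the flat cut out by the relations it
  satisfies. There are 1305 flats that meet the open positive cone. A tree whose nodes are flats,
  each carrying an integer point that satisfies no further relation, covers them all: a gap vector
  in a flat either has the pattern of that point or lies in a child, which imposes one more
  relation. On a line the primitive integer vector is itself the model. For the lower bound, the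
  relations satisfied by \<open>0, 6, 7, 12, 15, 24\<close> force the diameter of a model to be
  eight times its fourth gap, and the relations it violates exclude the gaps 1 and 2.
\<close>

section \<open>Linear forms in the parameters of a flat, and elimination of one parameter\<close>

text \<open>Polymorphic because the same integer forms are evaluated at real gap vectors and at
  integer models.\<close>

fun dot :: "'a::comm_ring_1 list \<Rightarrow> 'a list \<Rightarrow> 'a" where
  "dot (a # f) (b # x) = a * b + dot f x"
| "dot _ _ = 0"

text \<open>
  If \<open>a\<close> has pivot \<open>a\<^sub>i\<close>, the kernel of \<open>a\<close> is parametrised by
  \<open>x\<^sub>j = z\<^sub>j\<close> for \<open>j < i\<close> and \<open>x\<^sub>j = a\<^sub>i z\<^sub>j\<close> for \<open>j > i\<close>; \<open>elim a f\<close> is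
  the pullback of \<open>f\<close> along this parametrisation.
\<close>

fun elim :: "int list \<Rightarrow> int list \<Rightarrow> int list" where
  "elim (a # as) (f # fs) = (if a = 0 then f # elim as fs else map2 (\<lambda>b g. a * g - f * b) as fs)"
| "elim _ _ = []"

text \<open>The empty list acts as the zero form of every length, so \<open>combination\<close> can
  end in it without knowing the number of parameters.\<close>

fun add_form :: "int list \<Rightarrow> int list \<Rightarrow> int list" where
  "add_form (a # f) (b # g) = (a + b) # add_form f g"
| "add_form [] g = g"
| "add_form f [] = f"

fun combination :: "int list \<Rightarrow> int list list \<Rightarrow> int list" where
  "combination (c # w) (p # P) = add_form (map ((*) c) p) (combination w P)"
| "combination _ _ = []"

section \<open>Finite tests on integer vectors\<close>

text \<open>
  Unlike \<^const>\<open>list_ex\<close> and \<^const>\<open>list_all\<close>, the next two functions stop early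
  under \<open>code_simp\<close>, which evaluates both arguments of a connective but only the chosen branch
  of a conditional. To keep the evaluation short, divisibility is tested by trial multiplication, the rewriting of \<^const>\<open>gcd\<close> and
  \<open>dvd\<close> being far too slow; the candidates tried below are the values that occur.
\<close>

fun exists_in :: "('a \<Rightarrow> bool) \<Rightarrow> 'a list \<Rightarrow> bool" where
  "exists_in Q (x # xs) = (if Q x then True else exists_in Q xs)"
| "exists_in Q [] = False"

fun forall_in :: "('a \<Rightarrow> bool) \<Rightarrow> 'a list \<Rightarrow> bool" where
  "forall_in Q (x # xs) = (if Q x then forall_in Q xs else False)"
| "forall_in Q [] = True"

definition divides :: "int \<Rightarrow> int \<Rightarrow> bool" where
  "divides g c = exists_in (\<lambda>e. c = g * e)
     [1,2,3,4,5,6,7,8,9,10,11,12,13,14,15,16,17,18,19,20,21,22,23,24]"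

text \<open>A common divisor \<open>g\<close> with total at most \<open>24 * g\<close> is witness
  enough: dividing by it leaves integer gaps with total at most 24. For positive entries the
  quotients are then at most 24 as well, which is why \<open>divides\<close> tries no larger
  ones.\<close>

definition primitive_sum_le_24 :: "int list \<Rightarrow> bool" where
  "primitive_sum_le_24 s = (let t = sum_list s in
     exists_in (\<lambda>g. if t \<le> 24 * g then forall_in (divides g) s else False)
       [1,2,3,4,6,8,12,16,24,32,36])"

definition nonzero :: "int list \<Rightarrow> bool" where
  "nonzero f \<longleftrightarrow> exists_in (\<lambda>c. c \<noteq> 0) f"

section \<open>Certificates for flats and their checker\<close>

text \<open>
  \<open>Void w\<close> is a Farkas certificate that a flat misses the open positive cone: a nonnegative
  combination of the coordinates that vanishes on it. \<open>Plane y D\<close> and \<open>Flat y D cs\<close> give the model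
  with gaps \<open>dot p y / D\<close>, where \<open>p\<close> runs through the gaps as forms in the parameters of the flat;
  the denominator is needed because \<^const>\<open>elim\<close> parametrises only a sublattice.
\<close>

datatype cert = Void "int list" | Plane "int list" int | Flat "int list" int "cert list"

text \<open>The stored point represents the generic stratum of a flat, where no remaining relation
  holds. Gaps are measured in units of \<open>D\<close>; the case \<open>D = 1\<close> is split off
  to spare the search for a quotient.\<close>

definition model_ok :: "int list \<Rightarrow> int \<Rightarrow> int list list \<Rightarrow> int list list \<Rightarrow> int list list \<Rightarrow> bool" where
  "model_ok y D L N P \<longleftrightarrow> D > 0 \<and> P \<noteq> [] \<and>
     forall_in (\<lambda>p. length p = length y \<and> dot p y > 0 \<and>
       (if D = 1 then True else divides D (dot p y))) P \<and>
     (\<Sum>p\<leftarrow>P. dot p y) \<le> 24 * D \<and> forall_in (\<lambda>l. dot l y \<noteq> 0) L \<and> forall_in (\<lambda>l. dot l y \<noteq> 0) N"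

definition empty_ok :: "int list \<Rightarrow> int list list \<Rightarrow> bool" where
  "empty_ok w P \<longleftrightarrow> length w = length P \<and> forall_in (\<lambda>c. c \<ge> 0) w \<and> nonzero w \<and>
     \<not> nonzero (combination w P)"

text \<open>On a line every gap is a fixed coefficient times one parameter, so positive gaps require
  coefficients of one common sign. If there is a zero or a change of sign, the line misses the open
  cone and nothing has to be shown.\<close>

definition ray_ok :: "int list list \<Rightarrow> bool" where
  "ray_ok P \<longleftrightarrow> (let s = concat P in
     if forall_in (\<lambda>c. c > 0) s then primitive_sum_le_24 s
     else if forall_in (\<lambda>c. c < 0) s then primitive_sum_le_24 (map uminus s)
     else True)"

text \<open>
  \<open>P\<close> are the gaps, \<open>L\<close> the undecided relations and \<open>N\<close> the relations assumed nonzero. A relation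
  proportional to one in \<open>N\<close> needs no child.
\<close>

fun check :: "cert \<Rightarrow> int list list \<Rightarrow> int list list \<Rightarrow> int list list \<Rightarrow> bool"
and check_children :: "cert list \<Rightarrow> int list list \<Rightarrow> int list list \<Rightarrow> int list list \<Rightarrow> bool" where
  "check (Void w) L N P = empty_ok w P"
| "check (Plane y D) L N P = (let L' = filter nonzero L in
     length y = 2 \<and> model_ok y D L' N P \<and> forall_in (\<lambda>l. ray_ok (map (elim l) P)) L')"
| "check (Flat y D cs) L N P = (let L' = filter nonzero L in
     model_ok y D L' N P \<and> check_children cs L' N P)"
| "check_children cs [] N P = True"
| "check_children cs (l # L) N P =
    (if exists_in (\<lambda>n. \<not> nonzero (elim l n)) N then check_children cs L N P
     else case cs of [] \<Rightarrow> False
       | c # cs \<Rightarrow> check c (map (elim l) L) (map (elim l) N) (map (elim l) P) \<and>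
           check_children cs L (l # N) P)"

section \<open>The 35 relations between two-letter sums\<close>

text \<open>This is \<open>(t_k - t_i) - (t_j - t_l)\<close> written in the gaps
  \<open>t_(n+1) - t_n\<close>; it vanishes exactly when the outer pair \<open>i\<close>,
  \<open>j\<close> and the inner pair \<open>k\<close>, \<open>l\<close> have the same sum.\<close>

definition relation :: "nat \<Rightarrow> nat \<Rightarrow> nat \<Rightarrow> nat \<Rightarrow> int list" where
  "relation i k l j = map (\<lambda>n. if i \<le> n \<and> n < k then 1 else if l \<le> n \<and> n < j then - 1 else 0) [0..<5]"

text \<open>The index ranges encode \<open>i < k \<le> l < j\<close>: there are 15 choices with
  \<open>k < l\<close> and 20 with \<open>k = l\<close>.\<close>

definition relations :: "int list list" where
  "relations = [relation i k l j. i \<leftarrow> [0..<6], k \<leftarrow> [Suc i..<6], l \<leftarrow> [k..<6], j \<leftarrow> [Suc l..<6]]"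

definition gaps :: "int list list" where
  "gaps = [[1,0,0,0,0], [0,1,0,0,0], [0,0,1,0,0], [0,0,0,1,0], [0,0,0,0,1]]"

abbreviation rdot :: "int list \<Rightarrow> real list \<Rightarrow> real" where
  "rdot f x \<equiv> dot (map of_int f) x"

section \<open>Evaluation of forms, and elimination over the reals and over the integers\<close>

lemma exists_in_iff [simp]: "exists_in Q xs \<longleftrightarrow> (\<exists>x\<in>set xs. Q x)"
  by (induction xs) auto

lemma forall_in_iff [simp]: "forall_in Q xs \<longleftrightarrow> (\<forall>x\<in>set xs. Q x)"
  by (induction xs) auto

lemma divides_dvd: "divides g c \<Longrightarrow> g dvd c"
  unfolding divides_def exists_in_iff by (elim bexE) simp

lemma nonzero_iff: "nonzero f \<longleftrightarrow> (\<exists>c\<in>set f. c \<noteq> 0)"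
  by (simp add: nonzero_def)

lemma dot_not_nonzero:
  fixes x :: "'a :: comm_ring_1 list"
  shows "\<not> nonzero f \<Longrightarrow> dot (map of_int f) x = 0"
proof (induction f arbitrary: x)
  case (Cons a f)
  then show ?case by (cases x) (auto simp: nonzero_iff)
qed simp

lemma dot_not_nonzero_int: "\<not> nonzero f \<Longrightarrow> dot f y = (0::int)"
  using dot_not_nonzero[of f y] by simp

lemma dot_map2_elim:
  fixes x :: "'a :: comm_ring_1 list"
  assumes "length g = length f" "length x = length f"
  shows "dot (map of_int (map2 (\<lambda>b g. a * g - c * b) f g)) x =
    of_int a * dot (map of_int g) x - of_int c * dot (map of_int f) x"
  using assms
proof (induction f arbitrary: g x)
  case (Cons b f)
  then show ?case by (cases g; cases x) (auto simp: algebra_simps)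
qed simp

lemma dot_map_mult_right:
  fixes c :: "'a :: comm_ring_1"
  shows "dot f (map ((*) c) x) = c * dot f x"
proof (induction f arbitrary: x)
  case (Cons a f)
  then show ?case by (cases x) (auto simp: algebra_simps)
qed simp

lemma length_elim: "nonzero a \<Longrightarrow> length f = length a \<Longrightarrow> Suc (length (elim a f)) = length a"
proof (induction a f rule: elim.induct)
  case (1 a as f fs)
  then show ?case by (auto simp: nonzero_iff)
qed (auto simp: nonzero_iff)

text \<open>Restricted to its own kernel a form is zero: at the pivot the two cross products
  coincide.\<close>

lemma elim_self: "\<not> nonzero (elim a a)"
proof -
  have "map2 (\<lambda>b g. c * g - c * b) xs xs = map (\<lambda>_. 0) xs" for xs and c :: int
    by (induction xs) auto
  then show ?thesis
    by (induction a) (auto simp: nonzero_iff)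
qed

text \<open>Over the reals the parametrisation reaches the whole kernel: coordinates before the
  pivot are kept, those after it are divided by it, and the pivot coordinate is recovered from
  \<open>rdot a x = 0\<close>.\<close>

lemma elim_project:
  assumes "nonzero a" "length x = length a" "rdot a x = 0"
  obtains z where "Suc (length z) = length a"
    "\<And>f. length f = length a \<Longrightarrow> rdot f x = rdot (elim a f) z"
proof -
  have "\<exists>z. Suc (length z) = length a \<and> (\<forall>f. length f = length a \<longrightarrow> rdot f x = rdot (elim a f) z)"
    using assms
  proof (induction a arbitrary: x)
    case (Cons a as)
    then obtain u xs where x: "x = u # xs" "length xs = length as" by (cases x) auto
    show ?case
    proof (cases "a = 0")
      case True
      with Cons.prems x obtain z where z: "Suc (length z) = length as"
        "\<And>f. length f = length as \<Longrightarrow> rdot f xs = rdot (elim as f) z"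
        using Cons.IH[of xs] by (auto simp: nonzero_iff)
      show ?thesis
      proof (intro exI[of _ "u # z"] conjI allI impI)
        fix f :: "int list" assume "length f = length (a # as)"
        then show "rdot f x = rdot (elim (a # as) f) (u # z)"
          using z(2) True x by (cases f) auto
      qed (use z in auto)
    next
      case False
      have u: "u = - rdot as xs / of_int a"
        using Cons.prems(3) False x by (auto simp: field_simps)
      show ?thesis
      proof (intro exI[of _ "map ((*) (1 / of_int a)) xs"] conjI allI impI)
        fix f :: "int list" assume "length f = length (a # as)"
        then obtain c fs where f: "f = c # fs" "length fs = length as" by (cases f) auto
        show "rdot f x = rdot (elim (a # as) f) (map ((*) (1 / of_int a)) xs)"
          using f x False dot_map2_elim[of fs as xs a c] unfolding dot_map_mult_right
          by (simp add: u field_simps del: map_map)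
      qed (use x in auto)
    qed
  qed (simp add: nonzero_iff)
  then show ?thesis using that by blast
qed

text \<open>In the forward direction the parametrisation involves no division, so integer parameters
  give an integer point of the kernel.\<close>

lemma elim_lift:
  fixes z :: "int list"
  assumes "nonzero a" "Suc (length z) = length a"
  obtains y where "length y = length a" "\<And>f. length f = length a \<Longrightarrow> dot f y = dot (elim a f) z"
proof -
  have "\<exists>y. length y = length a \<and> (\<forall>f. length f = length a \<longrightarrow> dot f y = dot (elim a f) z)"
    using assms
  proof (induction a arbitrary: z)
    case (Cons a as)
    show ?case
    proof (cases "a = 0")
      case True
      with Cons.prems obtain u zs where z: "z = u # zs" "Suc (length zs) = length as"
        by (cases z; cases as) (auto simp: nonzero_iff)
      with True Cons.prems obtain y where y: "length y = length as"
        "\<And>f. length f = length as \<Longrightarrow> dot f y = dot (elim as f) zs"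
        using Cons.IH[of zs] by (auto simp: nonzero_iff)
      show ?thesis
      proof (intro exI[of _ "u # y"] conjI allI impI)
        fix f :: "int list" assume "length f = length (a # as)"
        then show "dot f (u # y) = dot (elim (a # as) f) z"
          using y(2) True z by (cases f) auto
      qed (use y in auto)
    next
      case False
      \<comment> \<open>The head is chosen so that \<open>a\<close> times it cancels the
        contribution \<open>a * dot as z\<close> of the scaled tail.\<close>
      show ?thesis
      proof (intro exI[of _ "(- dot as z) # map ((*) a) z"] conjI allI impI)
        fix f :: "int list" assume "length f = length (a # as)"
        then obtain c fs where f: "f = c # fs" "length fs = length as" by (cases f) auto
        show "dot f ((- dot as z) # map ((*) a) z) = dot (elim (a # as) f) z"
          using f Cons.prems False dot_map2_elim[of fs as z a c]
          by (simp add: dot_map_mult_right)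
      qed (use Cons.prems in auto)
    qed
  qed (simp add: nonzero_iff)
  then show ?thesis using that by blast
qed

section \<open>Models expressed in the parameters of a flat\<close>

text \<open>The invariant of the recursion. Here \<open>x\<close> holds the real parameters of the
  alphabet and \<open>y\<close> those of a model. The values of the gap forms and \<open>D\<close>
  pass unchanged from a child to its parent; only at the end are the gaps divided by
  \<open>D\<close>.\<close>

definition has_model :: "int list list \<Rightarrow> int list set \<Rightarrow> real list \<Rightarrow> bool" where
  "has_model P fs x \<longleftrightarrow> (\<exists>(y::int list) D. length y = length x \<and> D > 0 \<and>
     (\<forall>p\<in>set P. dot p y > 0 \<and> D dvd dot p y) \<and> (\<Sum>p\<leftarrow>P. dot p y) \<le> 24 * D \<and>
     (\<forall>f\<in>fs. rdot f x = 0 \<longleftrightarrow> dot f y = 0))"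

text \<open>The real point is projected to the kernel parameters, a model is found there, and its
  integer parameters are lifted back. The form \<open>a\<close> joins the controlled forms because
  it vanishes at \<open>x\<close> and, by \<open>elim_self\<close>, at the lifted point.\<close>

lemma has_model_elim:
  assumes "nonzero a" "length x = length a" "rdot a x = 0"
    and len: "\<And>f. f \<in> fs \<union> set P \<Longrightarrow> length f = length a"
    and z: "\<And>z. Suc (length z) = length a \<Longrightarrow>
       (\<And>f. length f = length a \<Longrightarrow> rdot f x = rdot (elim a f) z) \<Longrightarrow>
       has_model (map (elim a) P) (elim a ` fs) z"
  shows "has_model P (insert a fs) x"
proof -
  obtain z where z1: "Suc (length z) = length a"
    "\<And>f. length f = length a \<Longrightarrow> rdot f x = rdot (elim a f) z"
    using elim_project assms(1-3) by blast
  obtain w D where w: "length w = length z" "D > 0"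
     "\<And>p. p \<in> set P \<Longrightarrow> dot (elim a p) w > 0 \<and> D dvd dot (elim a p) w"
     "(\<Sum>p\<leftarrow>P. dot (elim a p) w) \<le> 24 * D"
     "\<And>f. f \<in> fs \<Longrightarrow> rdot (elim a f) z = 0 \<longleftrightarrow> dot (elim a f) w = 0"
    using z[OF z1] unfolding has_model_def by (auto simp: o_def)
  obtain y where y: "length y = length a"
    "\<And>f. length f = length a \<Longrightarrow> dot f y = dot (elim a f) w"
    using elim_lift[of a w] assms(1) w(1) z1(1) by auto
  have "(\<Sum>p\<leftarrow>P. dot p y) = (\<Sum>p\<leftarrow>P. dot (elim a p) w)"
    by (intro arg_cong[of _ _ sum_list] map_cong refl y(2) len) auto
  moreover have "dot a y = 0"
    using y(2)[of a] dot_not_nonzero_int[OF elim_self] by simp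
  ultimately show ?thesis
    unfolding has_model_def using y w assms(2,3) len z1
    by (intro exI[of _ y] exI[of _ D]) auto
qed

section \<open>Flats that miss the open positive cone\<close>

lemma dot_add_form:
  fixes x :: "'a :: comm_ring_1 list"
  shows "dot (map of_int (add_form f g)) x = dot (map of_int f) x + dot (map of_int g) x"
proof (induction f g arbitrary: x rule: add_form.induct)
  case (1 a f b g)
  then show ?case by (cases x) (auto simp: algebra_simps)
qed auto

lemma dot_map_mult_left:
  fixes x :: "'a :: comm_ring_1 list"
  shows "dot (map of_int (map ((*) c) f)) x = of_int c * dot (map of_int f) x"
proof (induction f arbitrary: x)
  case (Cons a f)
  then show ?case by (cases x) (auto simp: algebra_simps)
qed simp

text \<open>The weak and the strict inequality are proved together, since the positive weight may
  sit in the head or in the tail while the other part is merely nonnegative.\<close>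

lemma rdot_combination_nonneg:
  assumes "length w = length P" "\<forall>c\<in>set w. c \<ge> 0" "\<forall>p\<in>set P. rdot p x > 0"
  shows "rdot (combination w P) x \<ge> 0 \<and> (nonzero w \<longrightarrow> rdot (combination w P) x > 0)"
  using assms
proof (induction w P rule: combination.induct)
  case (1 c w p P)
  then show ?case
    by (auto simp: dot_add_form dot_map_mult_left nonzero_iff simp del: map_map
      intro: add_pos_nonneg add_nonneg_pos mult_nonneg_nonneg)
qed (auto simp: nonzero_iff)

text \<open>A nontrivial nonnegative combination of positive gaps is positive, whereas the
  certificate makes it the zero form.\<close>

lemma empty_ok_sound:
  assumes "empty_ok w P" "\<forall>p\<in>set P. rdot p x > 0"
  shows False
  using assms rdot_combination_nonneg[of w P x] dot_not_nonzero[of "combination w P" x]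
  by (auto simp: empty_ok_def)

section \<open>Flats of dimension one\<close>

lemma primitive_sum_le_24_sound:
  "primitive_sum_le_24 s \<Longrightarrow> \<exists>g>0. sum_list s \<le> 24 * g \<and> (\<forall>c\<in>set s. g dvd c)"
proof -
  assume "primitive_sum_le_24 s"
  then obtain g where "g \<in> set [1,2,3,4,6,8,12,16,24,32,36]" "sum_list s \<le> 24 * g"
    "\<forall>c\<in>set s. divides g c"
    unfolding primitive_sum_le_24_def Let_def exists_in_iff forall_in_iff
    by (auto simp del: set_simps split: if_splits)
  then show ?thesis by (intro exI[of _ g]) (auto intro: divides_dvd)
qed

lemma concat_singletons: "\<forall>p\<in>set P. length p = 1 \<Longrightarrow> map (\<lambda>c. [c]) (concat P) = P"
  by (induction P) (auto simp: length_Suc_conv)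

text \<open>A form in one parameter vanishes at a nonzero point only if its coefficient is zero.
  Hence the pattern of \<open>x\<close> is shared by every nonzero integer parameter, and only the
  sign and the common divisor of the gaps matter.\<close>

lemma ray_ok_sound:
  assumes "ray_ok P" "P \<noteq> []" "length x = 1"
    and len: "\<And>f. f \<in> fs \<union> set P \<Longrightarrow> length f = 1"
    and pos: "\<forall>p\<in>set P. rdot p x > 0"
  shows "has_model P fs x"
proof -
  obtain u where x: "x = [u]" using assms(3) by (cases x) auto
  have hd: "f = [hd f]" if "f \<in> fs \<union> set P" for f
    using len[OF that] by (cases f) auto
  have P: "P = map (\<lambda>c. [c]) (concat P)"
    using concat_singletons[of P] len by simp
  obtain s where s: "P = map (\<lambda>c. [c]) s" "concat P = s" using P by blast
  then have "s \<noteq> []" using assms(2) by auto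
  have u: "\<forall>c\<in>set s. of_int c * u > 0" using pos by (auto simp: s(1) x)
  \<comment> \<open>\<open>v\<close> is the sign of \<open>u\<close>; it is nonzero because there is
    at least one gap and it is positive.\<close>
  obtain v where v: "v = 1 \<or> v = (-1::int)" "\<forall>c\<in>set s. c * v > 0"
    "primitive_sum_le_24 (map (\<lambda>c. c * v) s)" "u \<noteq> 0"
  proof (cases "u > 0")
    case True
    then have "\<forall>c\<in>set s. c > 0" using u by (auto simp: zero_less_mult_iff)
    then show ?thesis using that[of 1] assms(1) True by (auto simp: ray_ok_def s(2))
  next
    case False
    then have "u < 0" using u \<open>s \<noteq> []\<close> by (cases s) (auto simp: zero_less_mult_iff)
    then have neg: "\<forall>c\<in>set s. c < 0" using u by (auto simp: zero_less_mult_iff)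
    then have "\<not> (\<forall>c\<in>set s. c > 0)" using \<open>s \<noteq> []\<close> by (cases s) auto
    then have "primitive_sum_le_24 (map uminus s)"
      using assms(1) neg unfolding ray_ok_def s(2) Let_def forall_in_iff by presburger
    then have "primitive_sum_le_24 (map (\<lambda>c. c * -1) s)" by (rule back_subst) simp
    then show ?thesis using that[of "-1"] neg \<open>u < 0\<close> by auto
  qed
  from primitive_sum_le_24_sound[OF v(3)] obtain g where g: "g > 0" "sum_list (map (\<lambda>c. c * v) s) \<le> 24 * g"
    "\<forall>c\<in>set s. g dvd c * v" by auto
  have "rdot f x = 0 \<longleftrightarrow> dot f [v] = 0" if "f \<in> fs" for f
    using hd[of f] that v(1,4) by (cases f) (auto simp: x)
  moreover have "dot p [v] > 0 \<and> g dvd dot p [v]" if "p \<in> set P" for p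
    using that v(2) g(3) by (auto simp: s(1))
  moreover have "(\<Sum>p\<leftarrow>P. dot p [v]) = sum_list (map (\<lambda>c. c * v) s)"
    by (simp add: s(1) o_def)
  ultimately show ?thesis unfolding has_model_def
    using g(1,2) x by (intro exI[of _ "[v]"] exI[of _ g]) simp
qed

section \<open>Generic points, and relations whose pattern is forced\<close>

text \<open>Neither \<open>x\<close> nor the stored point satisfies any of the listed relations, so
  their patterns agree.\<close>

lemma has_model_model_ok:
  assumes "model_ok y D L N P" "length x = length y" "\<forall>l\<in>set L. rdot l x \<noteq> 0" "\<forall>n\<in>set N. rdot n x \<noteq> 0"
  shows "has_model P (set L \<union> set N) x"
proof -
  have g: "D > 0" "(\<Sum>p\<leftarrow>P. dot p y) \<le> 24 * D" "\<forall>f\<in>set L \<union> set N. dot f y \<noteq> 0"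
    and p: "\<And>p. p \<in> set P \<Longrightarrow> dot p y > 0 \<and> (if D = 1 then True else divides D (dot p y))"
    using assms(1) unfolding model_ok_def by auto
  have "dot p y > 0 \<and> D dvd dot p y" if "p \<in> set P" for p
    using p[OF that] divides_dvd[of D "dot p y"] by (cases "D = 1") auto
  then show ?thesis unfolding has_model_def
    using g assms(2-4) by (intro exI[of _ y] exI[of _ D]) auto
qed

text \<open>Serves to bring back forms that the checker drops, namely zero forms and multiples of
  forms in \<open>N\<close>: their pattern follows from the forms already matched.\<close>

lemma has_model_extend:
  assumes "has_model P fs x"
    and "\<And>f y. f \<in> gs \<Longrightarrow> f \<notin> fs \<Longrightarrow> length y = length x \<Longrightarrow>
      \<forall>g\<in>fs. rdot g x = 0 \<longleftrightarrow> dot g y = 0 \<Longrightarrow> rdot f x = 0 \<longleftrightarrow> dot f y = 0"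
  shows "has_model P gs x"
proof -
  obtain y D where y: "length y = length x" "D > 0" "\<forall>p\<in>set P. dot p y > 0 \<and> D dvd dot p y"
    "(\<Sum>p\<leftarrow>P. dot p y) \<le> 24 * D" "\<forall>f\<in>fs. rdot f x = 0 \<longleftrightarrow> dot f y = 0"
    using assms(1) unfolding has_model_def by blast
  then have "\<forall>f\<in>gs. rdot f x = 0 \<longleftrightarrow> dot f y = 0"
    using assms(2)[of _ y] by blast
  with y show ?thesis unfolding has_model_def by blast
qed

lemma has_model_filter_nonzero:
  assumes "has_model P (set (filter nonzero L) \<union> fs) x"
  shows "has_model P (set L \<union> fs) x"
  by (rule has_model_extend[OF assms]) (auto simp: dot_not_nonzero dot_not_nonzero_int)

lemma rdot_of_int: "rdot f (map of_int y) = of_int (dot f y)"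
proof (induction f arbitrary: y)
  case (Cons a f)
  then show ?case by (cases y) auto
qed simp

text \<open>A zero pullback \<open>elim l n\<close> expresses that \<open>n\<close> vanishes on the
  kernel of \<open>l\<close>.\<close>

lemma rdot_eq_0_multiple:
  assumes "nonzero l" "length l = length x" "length n = length x" "\<not> nonzero (elim l n)" "rdot l x = 0"
  shows "rdot n x = 0"
  using elim_project[of l x] assms dot_not_nonzero[OF assms(4)] by metis

text \<open>Justifies skipping a child. A zero of \<open>l\<close> would be a zero of
  \<open>n\<close>, but \<open>n\<close> is nonzero at \<open>x\<close> and therefore also at the
  model; so \<open>l\<close> is nonzero at both.\<close>

lemma has_model_insert_multiple:
  assumes m: "has_model P fs x" and n: "n \<in> fs" "rdot n x \<noteq> 0"
    and l: "nonzero l" "length l = length x" "length n = length x" "\<not> nonzero (elim l n)"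
  shows "has_model P (insert l fs) x"
proof (rule has_model_extend[OF m])
  fix f and y :: "int list"
  assume f: "f \<in> insert l fs" "f \<notin> fs" and y: "length y = length x"
    and eq: "\<forall>g\<in>fs. rdot g x = 0 \<longleftrightarrow> dot g y = 0"
  have "rdot l x \<noteq> 0"
    using rdot_eq_0_multiple l n(2) by blast
  moreover have "dot l y \<noteq> 0"
    using rdot_eq_0_multiple[of l "map of_int y" n] l y n eq by (auto simp: rdot_of_int)
  ultimately show "rdot f x = 0 \<longleftrightarrow> dot f y = 0" using f by blast
qed

section \<open>Soundness of the checker\<close>

text \<open>Simultaneous induction over nodes and lists of children. At a node either no remaining
  relation holds at \<open>x\<close> and the stored point is a model, or the search through the
  children stops at the first relation that holds. Those passed over are known to fail at
  \<open>x\<close>. The assumption that some relation holds rules out reaching the end of the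
  list.\<close>

lemma check_sound:
  "check c L N P \<Longrightarrow> P \<noteq> [] \<Longrightarrow> (\<And>f. f \<in> set L \<union> set N \<union> set P \<Longrightarrow> length f = length x) \<Longrightarrow>
     (\<forall>p\<in>set P. rdot p x > 0) \<Longrightarrow> (\<forall>n\<in>set N. rdot n x \<noteq> 0) \<Longrightarrow>
     has_model P (set L \<union> set N) x"
  "check_children cs L N P \<Longrightarrow> P \<noteq> [] \<Longrightarrow> (\<And>f. f \<in> set L \<union> set N \<union> set P \<Longrightarrow> length f = length x) \<Longrightarrow>
     (\<forall>p\<in>set P. rdot p x > 0) \<Longrightarrow> (\<forall>n\<in>set N. rdot n x \<noteq> 0) \<Longrightarrow> (\<forall>l\<in>set L. nonzero l) \<Longrightarrow>
     (\<exists>l\<in>set L. rdot l x = 0) \<Longrightarrow> has_model P (set L \<union> set N) x"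
proof (induction c L N P and cs L N P arbitrary: x and x rule: check_check_children.induct)
  case (1 w L N P)
  then show ?case using empty_ok_sound[of w P x] by auto
next
  case (2 y D L N P)
  define L' where "L' = filter nonzero L"
  have c: "length y = 2" "model_ok y D L' N P" "\<forall>l\<in>set L'. ray_ok (map (elim l) P)"
    using 2(1) by (auto simp: Let_def L'_def)
  have xy: "length x = length y" using c(2) 2(2) 2(3) by (cases P) (auto simp: model_ok_def)
  have "has_model P (set L' \<union> set N) x"
  proof (cases "\<forall>l\<in>set L'. rdot l x \<noteq> 0")
    case True
    then show ?thesis using has_model_model_ok c(2) xy 2(5) by blast
  next
    case False
    \<comment> \<open>One more relation cuts a plane down to a line, where \<open>ray_ok\<close>
      decides without further branching.\<close>
    then obtain l where l: "l \<in> set L'" "rdot l x = 0" by blast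
    have nz: "nonzero l" and ll: "length l = length x" using l(1) 2(3) by (auto simp: L'_def)
    have "has_model P (insert l (set L' \<union> set N)) x"
    proof (rule has_model_elim[OF nz ll[symmetric] l(2)])
      fix z assume z: "Suc (length z) = length l"
        "\<And>f. length f = length l \<Longrightarrow> rdot f x = rdot (elim l f) z"
      have le: "length (elim l f) = 1" if "length f = length x" for f
        using length_elim[OF nz, of f] that ll xy c(1) by simp
      show "has_model (map (elim l) P) (elim l ` (set L' \<union> set N)) z"
      proof (rule ray_ok_sound)
        show "ray_ok (map (elim l) P)" using c(3) l(1) by blast
        show "length z = 1" using z(1) ll xy c(1) by simp
        show "\<forall>p\<in>set (map (elim l) P). rdot p z > 0" using z(2) 2(3,4) ll by auto
      qed (use 2(2,3) le in \<open>auto simp: L'_def\<close>)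
    qed (use 2(3) ll in \<open>auto simp: L'_def\<close>)
    then show ?thesis using l(1) by (simp add: insert_absorb)
  qed
  then show ?case using has_model_filter_nonzero unfolding L'_def by blast
next
  case (3 y D cs L N P)
  define L' where "L' = filter nonzero L"
  have c: "model_ok y D L' N P" "check_children cs L' N P"
    using 3(2) by (auto simp: Let_def L'_def)
  have xy: "length x = length y" using c(1) 3(3,4) by (cases P) (auto simp: model_ok_def)
  have "has_model P (set L' \<union> set N) x"
  proof (cases "\<forall>l\<in>set L'. rdot l x \<noteq> 0")
    case True
    then show ?thesis using has_model_model_ok c(1) xy 3(6) by blast
  next
    case False
    show ?thesis by (rule 3(1)[OF L'_def c(2) 3(3)]) (use 3(4-) False in \<open>auto simp: L'_def\<close>)
  qed
  then show ?case using has_model_filter_nonzero unfolding L'_def by blast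
next
  case (4 cs N P)
  then show ?case by auto
next
  case (5 cs l L N P)
  have nz: "nonzero l" and ll: "length l = length x" using 5(6,9) by auto
  show ?case
  proof (cases "\<exists>n\<in>set N. \<not> nonzero (elim l n)")
    case True
    then obtain n where n: "n \<in> set N" "\<not> nonzero (elim l n)" by blast
    have "length n = length x" "rdot n x \<noteq> 0" using n 5(6,8) by auto
    moreover have "rdot l x \<noteq> 0"
      using rdot_eq_0_multiple[OF nz ll _ n(2)] calculation by blast
    \<comment> \<open>Since \<open>l\<close> fails at \<open>x\<close>, the relation that holds
      there lies in the tail \<open>L\<close>.\<close>
    then have "has_model P (set L \<union> set N) x"
      using 5(1)[of x] True 5(4-) by auto
    ultimately show ?thesis
      using has_model_insert_multiple[of P "set L \<union> set N" x n l] n nz ll by simp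
  next
    case False
    then obtain c cs' where cs: "cs = c # cs'"
      "check c (map (elim l) L) (map (elim l) N) (map (elim l) P)" "check_children cs' L (l # N) P"
      using 5(4) by (auto split: list.splits)
    have na: "\<not> exists_in (\<lambda>n. \<not> nonzero (elim l n)) N" using False by simp
    show ?thesis
    proof (cases "rdot l x = 0")
      case True
      have "has_model P (insert l (set L \<union> set N)) x"
      proof (rule has_model_elim[OF nz ll[symmetric] True])
        fix z assume z: "Suc (length z) = length l"
          "\<And>f. length f = length l \<Longrightarrow> rdot f x = rdot (elim l f) z"
        have le: "length (elim l f) = length z" if "length f = length x" for f
          using length_elim[OF nz, of f] that ll z(1) by simp
        have "has_model (map (elim l) P) (set (map (elim l) L) \<union> set (map (elim l) N)) z"
          by (rule 5(2)[OF na cs(1,2)]) (use 5(5-8) le z(2) ll in auto)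
        then show "has_model (map (elim l) P) (elim l ` (set L \<union> set N)) z"
          by (simp add: image_Un)
      qed (use 5(6) ll in auto)
      then show ?thesis by simp
    next
      case f: False
      \<comment> \<open>The relation \<open>l\<close> fails at \<open>x\<close>, so it moves to the
        relations assumed nonzero and the search goes on.\<close>
      have "has_model P (set L \<union> set (l # N)) x"
        by (rule 5(3)[OF na cs(1,3)]) (use 5(5-) f in auto)
      then show ?thesis by simp
    qed
  qed
qed

section \<open>The tree of flats\<close>

text \<open>The length of a stored point is the dimension of its flat. Children come in the order in
  which \<open>check_children\<close> consumes the relations, without entries for skipped ones. The
  root point gives the Golomb ruler 0, 1, 4, 10, 12, 17, which satisfies no relation.\<close>

definition certificate :: cert where
  "certificate =
    Flat [1,3,6,2,5] 1 [ Flat [1,4,7,3] 1 [ Void [0,0,1,0,0], Void [0,0,1,1,0], Void [0,0,1,1,1],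
    Flat [1,5,4] 1 [ Void [0,0,0,1,0], Void [0,0,0,1,1], Plane [1,5] 1, Plane [1,2] 1,
    Plane [4,1] 1, Plane [1,3] 1, Plane [3,1] 2, Plane [2,1] 1, Plane [3,7] 3, Plane [5,1] 3,
    Plane [4,3] 3, Plane [4,7] 3, Plane [2,3] 1, Plane [4,5] 1, Plane [1,4] 1], Flat [2,3,1] 1 [
    Void [0,0,0,0,1], Plane [2,1] 1, Plane [2,3] 1, Void [0,1,0,1,0], Void [0,1,1,0,0],
    Plane [1,2] 1, Plane [1,3] 1, Void [0,1,2,0,0], Plane [2,5] 3, Plane [2,7] 3, Plane [2,9] 3,
    Plane [1,4] 2, Plane [1,7] 1, Plane [1,2] 1, Plane [3,1] 1], Flat [1,3,2] 1 [ Void [0,0,1,0,1],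
    Void [0,1,0,1,1], Void [0,1,0,0,1], Void [0,1,1,0,1], Void [0,1,1,0,0], Void [0,1,1,1,0],
    Void [0,1,2,0,1], Void [0,1,2,0,0], Void [0,1,2,1,0], Void [0,1,2,2,0], Void [0,0,2,0,1],
    Void [0,0,2,1,0], Plane [1,3] 1, Plane [1,2] 1, Plane [2,1] 1, Plane [2,3] 1, Plane [1,2] 1],
    Flat [5,1,3] 1 [ Void [0,0,0,0,1], Plane [3,1] 1, Plane [-1,-6] 1, Plane [-3,-2] 1,
    Void [0,0,0,1,0], Plane [4,1] 1, Plane [1,4] 1, Plane [1,5] 1, Plane [1,6] 1, Plane [1,3] 1,
    Plane [1,3] 1], Flat [4,1,2] 1 [ Void [0,0,0,1,0], Plane [-1,-2] 1, Plane [-2,-1] 1,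
    Void [0,1,0,0,1], Void [0,1,0,0,0], Void [0,1,0,1,0], Void [0,1,1,0,1], Void [0,1,1,1,0],
    Void [0,1,1,2,0], Void [0,0,1,0,1], Void [0,0,1,2,0], Plane [2,1] 1, Plane [1,3] 1,
    Plane [5,1] 1], Flat [5,3,1] 1 [ Plane [-5,-1] 1, Plane [-5,-3] 1, Plane [4,-1] 1,
    Void [0,0,0,0,1], Plane [5,1] 1, Plane [4,1] 1, Void [0,0,1,0,1], Plane [3,1] 1,
    Plane [3,1] 1], Flat [2,5,6] 2 [ Void [0,0,0,1,0], Void [0,0,0,1,1], Plane [2,7] 4,
    Plane [1,3] 4, Plane [5,2] 4, Plane [4,5] 8, Plane [3,5] 8, Plane [5,4] 8, Plane [5,9] 8,
    Plane [3,8] 6, Plane [5,1] 6, Plane [5,3] 6, Plane [5,8] 6, Plane [5,7] 4, Plane [4,5] 4],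
    Flat [3,1,9] 2 [ Void [0,0,0,0,1], Plane [1,3] 4, Plane [5,6] 4, Plane [5,2] 8, Plane [1,7] 8,
    Plane [1,8] 8, Plane [3,7] 6, Plane [4,1] 6, Plane [1,5] 6, Plane [5,9] 6, Plane [1,4] 4,
    Plane [10,1] 4], Flat [5,1,2] 2 [ Void [0,0,1,0,1], Void [0,0,2,0,1], Void [0,0,2,1,0],
    Plane [5,2] 6, Plane [1,5] 6, Plane [2,5] 6, Plane [2,9] 6, Plane [3,2] 4, Plane [6,1] 4,
    Plane [8,1] 4], Flat [6,2,3] 2 [ Void [0,0,0,0,1], Plane [5,1] 2, Plane [2,3] 4, Plane [2,5] 4,
    Plane [2,7] 4, Plane [2,3] 4, Plane [1,2] 2, Plane [1,3] 2, Plane [2,3] 4], Flat [5,1,3] 2 [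
    Void [0,0,0,1,0], Void [0,0,1,0,1], Void [0,0,1,2,0], Plane [2,1] 2, Plane [1,7] 4,
    Plane [3,1] 4, Plane [1,5] 4], Flat [3,6,2] 2 [ Plane [5,2] 4, Plane [3,2] 4, Plane [2,1] 2,
    Plane [3,2] 4, Plane [3,2] 4], Flat [4,6,3] 2 [ Void [0,0,0,0,1], Plane [6,5] 4, Plane [6,5] 4,
    Void [0,1,0,0,0], Void [0,1,0,0,1], Plane [5,3] 2, Plane [5,8] 2, Void [0,2,0,0,1],
    Plane [5,1] 4, Plane [5,6] 4], Flat [5,3,4] 2 [ Void [0,0,0,1,0], Void [0,1,0,0,0],
    Plane [1,8] 2, Plane [8,3] 4], Flat [4,3,6] 2 [ Plane [4,5] 2, Void [0,1,0,1,0],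
    Void [0,1,0,0,0], Plane [3,5] 4, Void [0,2,0,1,0]], Flat [4,3,9] 2 [ Plane [4,9] 2,
    Void [0,1,0,2,0], Void [0,1,0,1,0], Void [0,1,0,0,0], Plane [3,8] 4, Void [0,2,0,1,0],
    Void [0,2,1,0,0]], Flat [3,5,1] 1 [ Void [0,0,0,0,1], Plane [3,4] 1, Plane [3,4] 1,
    Void [0,1,0,0,1], Plane [4,3] 1, Plane [4,7] 1], Flat [6,3,4] 1 [ Void [0,0,0,1,0],
    Plane [2,3] 1, Plane [5,3] 1], Flat [4,3,5] 1 [ Plane [3,4] 1], Flat [4,3,8] 1 [ Plane [3,7] 1,
    Void [0,1,0,2,0], Void [0,1,0,1,0], Void [0,1,1,0,0]], Flat [1,4,3] 1 [ Void [0,0,0,0,1],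
    Plane [1,3] 1, Plane [1,3] 1], Flat [4,2,1] 1 [ Void [0,0,0,1,0], Plane [1,3] 1],
    Flat [2,6,1] 1 [], Flat [1,3,7] 1 [], Flat [1,5,4] 1 []], Flat [2,1,7,4] 1 [ Void [0,0,0,1,0],
    Void [0,0,0,1,1], Void [0,1,0,0,0], Flat [1,3,2] 1 [ Void [0,0,0,0,1], Plane [1,2] 1,
    Plane [1,3] 1, Plane [1,2] 1, Void [1,0,0,0,0], Plane [1,4] 1, Void [1,0,1,0,0], Plane [1,5] 2,
    Plane [1,6] 2, Plane [1,7] 2, Plane [-1,-6] 1, Void [0,0,1,0,1], Plane [1,2] 1],
    Flat [2,3,1] 1 [ Void [0,0,1,0,1], Void [0,0,1,1,0], Void [0,1,0,0,1], Void [1,0,0,0,1],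
    Void [1,0,0,0,0], Void [1,0,0,1,0], Void [1,0,1,0,1], Void [1,0,1,0,0], Void [1,0,1,1,0],
    Void [1,0,1,2,0], Plane [-1,-2] 1, Plane [-2,-1] 1, Void [0,0,1,2,0], Plane [2,1] 1,
    Plane [1,3] 1, Plane [3,1] 1], Flat [3,4,2] 1 [ Void [0,0,0,0,1], Plane [2,3] 1,
    Plane [-2,-5] 2, Plane [-2,-1] 1, Plane [-3,-1] 1, Plane [-3,-4] 1, Plane [2,3] 1,
    Plane [2,3] 1, Void [0,0,2,0,1], Void [0,1,0,0,1], Plane [3,2] 1, Plane [3,4] 1],
    Flat [4,3,2] 1 [ Plane [-2,-3] 2, Plane [-3,-1] 2, Void [0,1,0,0,1], Void [0,1,0,1,0],
    Void [1,0,0,0,1], Void [1,0,0,1,0], Void [1,0,0,2,0], Plane [-1,-4] 2, Plane [-3,-1] 1,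
    Plane [1,4] 1, Plane [5,3] 1], Flat [2,5,3] 1 [ Plane [-4,-3] 2, Plane [-1,-2] 1,
    Plane [-4,-3] 1, Plane [2,-3] 1, Void [0,0,0,0,1], Plane [-5,-2] 2, Void [0,0,2,1,0],
    Plane [1,4] 1, Void [0,1,0,1,0]], Flat [3,2,7] 2 [ Void [0,0,0,0,1], Plane [4,1] 4,
    Plane [4,5] 4, Plane [3,1] 4, Plane [2,3] 4, Plane [2,5] 4, Void [1,0,0,0,0], Void [1,0,0,0,1],
    Plane [4,1] 2, Plane [4,7] 4, Plane [2,7] 4, Plane [2,3] 4, Plane [1,2] 2], Flat [1,2,6] 2 [
    Void [0,0,1,0,1], Void [0,0,1,1,0], Void [0,0,2,0,1], Void [0,0,2,1,0], Void [1,0,0,0,0],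
    Plane [1,7] 4, Plane [3,1] 4, Plane [1,3] 4, Plane [5,1] 4, Plane [3,5] 4], Flat [2,4,5] 2 [
    Void [0,0,0,0,1], Plane [1,1] 1, Plane [2,1] 2, Plane [2,3] 2, Plane [2,5] 2, Plane [-1,-2] 2,
    Void [1,0,1,0,0], Void [1,0,1,0,1], Plane [-4,-1] 2, Plane [4,7] 2, Void [0,2,0,0,1]],
    Flat [1,5,2] 2 [ Void [0,0,1,0,1], Void [0,0,1,1,0], Void [0,0,1,2,0], Plane [-5,-1] 6,
    Plane [-2,-5] 6, Void [1,0,1,0,0], Plane [1,6] 2, Plane [3,2] 4, Plane [8,3] 4],
    Flat [2,5,4] 2 [ Plane [3,2] 2, Plane [3,5] 4, Plane [-5,-3] 6, Plane [-2,-7] 6,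
    Void [1,0,1,1,0], Void [1,0,0,0,0], Void [0,2,0,1,0]], Flat [1,6,4] 2 [ Void [0,0,0,0,1],
    Plane [2,3] 2, Plane [2,3] 2, Plane [-4,-7] 8, Void [1,0,2,0,0], Void [1,0,2,0,1],
    Plane [-6,-1] 4, Plane [2,3] 2, Void [1,1,0,0,0], Void [1,1,0,0,1], Plane [6,1] 4,
    Plane [6,7] 4], Flat [3,6,2] 2 [ Plane [-1,-7] 8, Plane [-1,-9] 8, Void [1,0,2,0,0],
    Plane [-5,-1] 4, Plane [5,3] 2, Void [1,1,0,0,0], Plane [3,7] 4], Flat [2,5,6] 2 [
    Plane [-5,-4] 8, Plane [-1,-4] 4, Void [1,0,2,1,0], Void [1,0,1,0,0], Plane [1,8] 4,
    Void [1,1,0,1,0], Void [1,1,0,0,0]], Flat [2,5,11] 2 [ Plane [-5,-9] 8, Plane [-1,-5] 4,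
    Void [1,0,2,2,0], Void [1,0,1,1,0], Void [1,0,0,0,0], Plane [1,9] 4, Void [1,1,0,2,0],
    Void [1,1,0,1,0], Void [1,1,0,0,0]], Flat [1,6,5] 1 [ Plane [5,1] 1, Plane [5,7] 2,
    Plane [5,6] 1, Plane [1,5] 1], Flat [2,3,1] 1 [ Void [0,0,0,0,1], Plane [2,3] 1, Plane [1,6] 2,
    Plane [1,8] 1, Plane [1,2] 1, Plane [1,3] 1], Flat [1,3,2] 1 [ Void [0,0,1,1,0], Plane [1,3] 1,
    Plane [1,2] 1, Plane [2,1] 1, Plane [2,3] 1, Plane [1,2] 1], Flat [2,7,1] 1 [ Plane [1,2] 1],
    Flat [2,5,8] 1 [ Plane [1,6] 1, Void [0,1,0,2,0], Void [0,1,0,1,0]], Flat [1,4,3] 1 [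
    Void [0,0,0,0,1], Plane [4,1] 1, Plane [5,1] 1], Flat [1,3,2] 1 [ Plane [5,1] 1],
    Flat [1,5,2] 1 [], Flat [1,5,7] 1 [], Flat [1,2,5] 1 []], Flat [1,2,4,5] 1 [ Void [0,0,0,0,1],
    Void [0,1,0,1,0], Void [0,1,0,0,0], Flat [2,4,1] 1 [ Void [0,0,1,0,1], Void [0,0,1,0,0],
    Void [0,0,0,1,2], Void [0,0,1,0,2], Void [1,0,0,0,0], Void [0,0,2,0,1], Void [1,0,1,0,0],
    Void [1,0,1,1,0], Plane [-3,-1] 1, Plane [-2,-3] 1, Plane [3,-1] 1, Plane [3,1] 1,
    Plane [2,1] 1, Plane [2,1] 1], Void [0,1,1,0,0], Flat [3,2,4] 1 [ Void [0,2,0,1,0],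
    Plane [-3,-2] 2, Void [0,1,0,0,1], Void [1,0,0,0,0], Void [1,0,0,1,0], Plane [-1,-2] 1,
    Void [0,0,2,1,0], Plane [-1,-3] 1, Plane [2,-3] 1, Plane [2,3] 1], Flat [3,2,6] 1 [
    Void [0,2,0,1,0], Plane [-1,-3] 1, Void [0,2,1,0,0], Plane [-1,-4] 1, Plane [2,-3] 1,
    Plane [-3,-5] 2, Void [0,0,1,2,0], Plane [2,5] 1, Void [0,1,0,2,0]], Void [0,2,0,1,0],
    Flat [1,5,4] 2 [ Void [0,0,1,0,1], Void [0,0,1,0,0], Void [0,0,2,1,0], Void [1,0,0,0,0],
    Plane [1,-2] 2, Plane [2,1] 2, Plane [3,2] 4, Plane [1,6] 4, Plane [1,4] 4, Plane [2,1] 2,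
    Plane [5,6] 4, Plane [1,2] 2], Void [0,2,1,0,0], Flat [3,1,7] 2 [ Void [0,0,1,2,0],
    Plane [-4,-3] 6, Plane [-2,-7] 6, Void [1,0,1,0,0], Void [1,0,0,0,0], Plane [3,4] 2,
    Plane [1,7] 4, Plane [2,5] 4, Plane [1,1] 1], Flat [3,2,7] 2 [ Plane [1,3] 2, Void [0,0,1,0,0],
    Plane [-1,-2] 2, Plane [-2,-9] 6, Void [1,0,1,1,0], Plane [-1,-5] 2, Void [1,0,0,1,0],
    Plane [3,7] 2, Void [0,1,0,2,0]], Flat [3,2,8] 2 [ Plane [-1,-8] 8, Plane [-1,-4] 4,
    Void [1,0,2,0,0], Plane [-1,-6] 4, Void [1,0,1,0,0], Void [1,0,0,0,0], Void [1,1,0,0,0],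
    Plane [2,3] 2, Plane [2,3] 2], Flat [3,2,10] 2 [ Plane [-3,-7] 8, Plane [-1,-5] 4,
    Void [1,0,2,1,0], Plane [-1,-7] 4, Void [1,0,1,1,0], Plane [2,-3] 2, Void [1,0,0,1,0],
    Plane [1,4] 2, Void [1,1,0,1,0], Void [1,1,0,0,0]], Flat [3,2,12] 2 [ Plane [-3,-10] 8,
    Plane [-1,-6] 4, Void [1,0,2,2,0], Plane [-1,-8] 4, Void [1,0,1,2,0], Plane [2,-3] 2,
    Void [1,0,0,2,0], Plane [1,5] 2, Void [1,1,0,2,0], Void [1,1,0,1,0], Void [1,1,0,0,0],
    Void [1,1,1,0,0]], Flat [1,3,8] 1 [ Void [0,0,0,1,1], Plane [1,7] 1, Plane [1,2] 1,
    Plane [2,7] 2, Plane [3,1] 2, Plane [4,5] 1, Plane [3,1] 1], Flat [1,2,5] 1 [ Void [0,0,1,0,0],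
    Plane [2,1] 1, Plane [1,4] 2, Plane [1,9] 1, Plane [1,2] 1, Plane [3,1] 1], Flat [1,3,2] 1 [
    Void [0,0,1,0,1], Void [0,0,1,0,0], Void [0,0,2,0,1], Plane [1,3] 1, Plane [1,2] 1,
    Plane [2,1] 1, Plane [2,3] 1, Plane [1,2] 1], Flat [1,3,2] 1 [ Plane [2,1] 1, Plane [1,3] 1],
    Flat [4,1,2] 1 [ Void [0,0,1,0,1], Plane [1,3] 1, Plane [1,3] 1, Plane [3,1] 1],
    Flat [1,4,2] 1 [ Void [0,1,0,0,1], Plane [3,1] 1, Plane [3,5] 1], Flat [4,2,3] 1 [
    Plane [2,3] 1, Plane [5,3] 1], Flat [1,2,7] 1 [ Plane [4,1] 1, Plane [5,1] 1], Flat [2,1,3] 1 [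
    Plane [5,1] 1], Flat [1,2,3] 1 [], Flat [5,1,3] 1 [ Void [0,0,1,0,0]], Flat [3,4,1] 1 []],
    Flat [1,3,5,2] 1 [ Void [0,1,0,1,1], Void [0,1,0,0,1], Void [0,1,0,0,0], Void [0,1,1,0,1],
    Void [0,1,1,0,0], Void [0,1,1,1,0], Void [0,2,0,1,1], Void [0,2,0,0,1], Void [0,2,1,0,1],
    Void [0,2,1,0,0], Void [0,2,1,1,0], Void [0,2,2,0,1], Void [0,2,2,1,0], Flat [1,4,3] 1 [
    Void [0,0,0,1,0], Plane [1,4] 1, Plane [1,2] 1, Plane [3,1] 1, Plane [2,5] 2, Plane [3,1] 2,
    Plane [3,2] 2, Plane [3,5] 2, Plane [3,4] 1, Plane [1,3] 1], Flat [1,2,5] 1 [ Void [0,0,1,0,0],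
    Plane [2,1] 1, Plane [2,3] 1, Plane [1,4] 2, Plane [1,2] 1, Plane [1,3] 1, Plane [1,5] 1,
    Plane [1,2] 1, Plane [3,1] 1], Flat [1,3,2] 1 [ Void [0,0,1,0,1], Void [0,0,1,0,0],
    Void [0,0,1,1,0], Void [0,0,2,0,1], Void [0,0,2,1,0], Plane [1,3] 1, Plane [1,2] 1,
    Plane [2,1] 1, Plane [2,3] 1, Plane [1,2] 1], Flat [4,1,2] 1 [ Plane [3,1] 1, Plane [1,2] 1,
    Plane [1,3] 1, Plane [1,4] 1, Plane [1,2] 1], Flat [4,1,2] 1 [ Void [0,0,0,1,0],
    Void [0,0,1,0,1], Void [0,0,1,1,0], Void [0,0,1,2,0], Plane [2,1] 1, Plane [1,3] 1,
    Plane [3,1] 1], Flat [2,4,1] 1 [ Plane [3,1] 1, Plane [2,1] 1, Void [0,0,1,0,0],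
    Plane [2,1] 1], Flat [2,3,4] 1 [ Plane [2,3] 1, Plane [2,3] 1, Plane [3,1] 1, Plane [3,4] 1],
    Flat [4,2,3] 1 [ Void [0,0,0,1,0], Plane [1,4] 1, Plane [3,2] 1], Flat [2,4,3] 1 [
    Plane [2,3] 1, Void [0,1,0,1,0]], Flat [3,2,6] 1 [ Plane [2,5] 1, Void [0,1,0,2,0],
    Void [0,1,0,1,0]], Flat [1,3,2] 1 [ Plane [1,2] 1, Plane [1,2] 1], Flat [2,1,3] 1 [
    Void [0,0,0,1,0], Plane [1,2] 1], Flat [2,4,1] 1 [], Flat [1,2,5] 1 [ Void [0,0,1,0,0]],
    Flat [3,4,1] 1 []], Flat [3,1,6,2] 1 [ Void [0,0,0,1,0], Void [0,0,0,1,1], Flat [6,1,3] 1 [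
    Void [0,0,0,0,1], Plane [4,1] 1, Plane [1,3] 1, Plane [2,1] 1, Plane [1,4] 1, Plane [1,5] 1,
    Plane [1,6] 1, Plane [1,6] 1, Plane [1,3] 1, Plane [5,1] 1], Flat [4,2,1] 1 [ Plane [1,2] 1,
    Void [0,1,0,0,1], Void [0,1,1,0,1], Void [0,1,1,1,0], Void [0,1,1,2,0], Plane [1,2] 1,
    Plane [1,2] 1, Plane [2,1] 1, Void [0,1,0,2,0], Plane [5,1] 1], Flat [2,5,1] 1 [ Plane [2,1] 1,
    Plane [2,1] 1, Plane [3,1] 1, Plane [4,1] 1, Void [0,1,0,0,1], Plane [2,1] 1], Flat [2,3,1] 1 [
    Void [0,0,0,0,1], Void [0,0,1,0,0], Plane [2,3] 1, Plane [3,2] 2, Plane [1,2] 1, Plane [1,3] 1,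
    Void [0,0,1,0,1], Plane [3,1] 1, Plane [2,5] 1], Flat [1,3,2] 1 [ Void [0,0,1,0,1],
    Void [0,0,1,0,0], Void [0,0,1,1,0], Void [0,0,2,0,1], Void [0,0,2,1,0], Void [0,0,1,2,0],
    Plane [2,3] 1, Plane [1,2] 1], Flat [1,4,2] 1 [ Void [0,0,0,0,1], Plane [1,3] 1, Plane [3,4] 1,
    Plane [3,7] 1, Void [0,0,2,0,1], Plane [-3,-2] 1, Plane [1,3] 1], Flat [2,4,1] 1 [
    Void [0,0,1,0,1], Void [0,0,1,1,0], Void [0,0,1,2,0], Plane [-3,-2] 2, Plane [2,3] 1,
    Plane [3,2] 1], Flat [1,5,3] 1 [ Plane [4,3] 1, Void [0,0,1,0,0], Plane [-1,-2] 1,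
    Void [0,0,2,1,0]], Flat [1,5,2] 1 [ Void [0,0,0,0,1], Plane [1,4] 1, Plane [1,4] 1,
    Void [0,0,3,0,1], Plane [-2,-1] 1, Plane [-4,-7] 1, Plane [4,5] 1], Flat [2,6,1] 1 [
    Plane [-4,-3] 3, Plane [-4,-1] 2, Plane [-1,-7] 1, Plane [3,4] 1, Plane [1,4] 1],
    Flat [1,5,4] 1 [ Plane [-2,-5] 3, Void [0,0,3,1,0]], Flat [1,2,8] 1 [ Plane [-2,-7] 3,
    Void [0,0,3,2,0], Void [0,0,2,1,0], Void [0,0,1,0,0], Void [0,1,1,0,0], Void [0,1,2,0,0]],
    Flat [2,3,1] 1 [ Void [0,0,0,0,1], Plane [1,3] 1, Plane [1,3] 1, Plane [3,1] 1],
    Flat [1,3,2] 1 [ Void [0,0,1,1,0], Plane [2,3] 1, Plane [1,2] 1], Flat [1,5,2] 1 [],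
    Flat [1,2,7] 1 [ Void [0,1,1,0,0]], Flat [5,1,3] 1 [ Void [0,0,1,0,0]], Flat [6,1,2] 1 []],
    Flat [6,2,1,4] 1 [ Void [0,0,0,0,1], Void [0,0,1,0,0], Flat [4,1,2] 1 [ Void [0,1,0,1,0],
    Plane [1,2] 1, Void [0,1,0,0,2], Void [1,1,0,0,0], Void [1,1,0,1,0], Plane [2,1] 1,
    Plane [3,1] 1, Plane [4,-1] 1], Flat [5,1,3] 1 [ Void [0,1,0,1,0], Void [0,1,1,0,0],
    Void [0,1,2,0,0], Plane [3,4] 1, Plane [3,4] 1, Plane [2,3] 1, Plane [1,3] 1, Plane [2,3] 1,
    Plane [5,-1] 1], Void [0,1,0,1,0], Flat [1,2,4] 1 [ Void [0,0,1,0,1], Void [1,0,0,0,0],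
    Void [0,0,2,0,1], Void [1,0,1,0,0], Plane [3,2] 1, Plane [1,3] 1, Plane [1,2] 1],
    Void [0,1,1,0,0], Flat [1,2,5] 1 [ Void [0,0,1,0,1], Void [1,0,0,0,0], Void [1,0,0,1,0],
    Plane [-3,-2] 2, Void [1,0,1,0,0], Plane [1,-3] 1, Plane [1,4] 1], Flat [3,1,6] 1 [
    Void [0,1,2,0,0], Plane [1,5] 1, Plane [-1,-5] 2, Void [1,0,0,1,0], Plane [1,-3] 1,
    Void [0,1,0,2,0]], Void [0,1,2,0,0], Flat [1,2,6] 1 [ Plane [-1,-6] 3, Void [1,0,2,0,0],
    Void [1,0,1,0,0], Void [1,0,0,0,0], Void [1,1,0,0,0], Plane [1,4] 1], Flat [1,2,8] 1 [
    Plane [-1,-7] 3, Void [2,0,1,0,0], Plane [-3,-7] 1, Void [1,0,0,1,0], Plane [1,6] 1,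
    Void [1,1,0,1,0]], Flat [1,2,10] 1 [ Plane [-1,-8] 3, Void [2,0,0,1,0], Plane [-3,-10] 1,
    Void [1,0,0,2,0], Plane [1,7] 1, Void [1,1,0,2,0], Void [1,1,1,0,0]], Flat [1,3,7] 1 [
    Void [0,0,0,1,1], Plane [1,2] 1, Plane [1,3] 1, Plane [3,1] 2, Plane [3,1] 1], Flat [1,3,2] 1 [
    Void [0,0,2,0,1], Plane [1,3] 1, Plane [1,2] 1, Plane [1,2] 1], Flat [2,1,4] 1 [
    Void [0,0,1,0,1], Plane [1,3] 1, Plane [3,1] 1], Flat [1,3,5] 1 [], Flat [2,1,5] 1 [
    Plane [3,2] 1], Flat [6,1,3] 1 [], Flat [5,1,2] 1 [ Plane [5,1] 1], Flat [6,1,2] 1 []],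
    Flat [7,1,3,2] 1 [ Void [0,0,1,0,1], Void [0,0,1,0,0], Void [0,0,1,1,0], Void [0,1,0,1,1],
    Void [0,1,0,0,1], Void [0,1,1,0,1], Void [0,1,1,0,0], Void [0,1,1,1,0], Void [0,1,2,0,1],
    Void [0,1,2,0,0], Void [0,1,2,1,0], Void [0,1,2,2,0], Flat [1,4,3] 1 [ Void [0,0,0,1,0],
    Plane [2,1] 1, Plane [4,1] 2, Plane [3,1] 2, Plane [3,2] 2, Plane [1,5] 2, Plane [3,4] 1,
    Plane [3,1] 1], Flat [2,3,1] 1 [ Plane [3,2] 2, Plane [1,2] 1, Plane [1,3] 1, Plane [2,1] 1,
    Plane [1,2] 1, Plane [3,1] 1], Flat [1,3,2] 1 [ Plane [2,1] 1, Plane [1,3] 1, Plane [1,4] 1,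
    Plane [1,2] 1], Flat [1,4,2] 1 [ Plane [1,3] 1, Plane [1,3] 1, Plane [3,1] 1, Plane [3,4] 1],
    Flat [2,4,1] 1 [ Void [0,0,0,1,0], Plane [2,3] 1, Plane [3,2] 1], Flat [1,4,3] 1 [
    Plane [1,4] 1, Void [0,1,0,1,0]], Flat [3,1,6] 1 [ Plane [1,5] 1, Void [0,1,0,2,0],
    Void [0,1,0,1,0]], Flat [6,1,3] 1 [ Plane [4,1] 1, Plane [5,1] 1], Flat [4,2,1] 1 [
    Void [0,0,0,1,0], Plane [5,1] 1], Flat [5,2,1] 1 [], Flat [5,1,3] 1 [], Flat [3,4,1] 1 []],
    Flat [2,6,1,4] 1 [ Void [0,0,0,0,1], Flat [3,5,1] 1 [ Plane [4,1] 1, Plane [3,1] 1,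
    Plane [3,1] 1, Void [0,1,0,0,0], Plane [3,1] 1, Plane [4,1] 1, Plane [5,3] 1, Plane [5,1] 1],
    Flat [5,1,2] 1 [ Void [0,0,0,1,0], Void [0,0,0,1,1], Plane [1,2] 1, Plane [1,3] 1,
    Plane [1,5] 2, Plane [1,6] 2, Plane [1,7] 2, Void [0,0,0,2,1], Plane [1,2] 1, Plane [3,2] 2,
    Plane [2,5] 1], Flat [4,1,2] 1 [ Plane [1,2] 1, Plane [1,4] 1, Plane [1,4] 2, Plane [1,5] 2,
    Plane [1,6] 2, Void [0,0,0,1,1], Plane [1,2] 1, Plane [3,1] 2], Flat [2,1,4] 1 [
    Void [0,0,1,1,0], Void [0,0,2,1,0], Void [0,0,0,1,0], Plane [1,2] 1, Plane [1,2] 1,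
    Plane [1,2] 1, Plane [1,3] 1], Void [0,1,0,0,0], Flat [4,1,2] 1 [ Void [0,0,0,1,0],
    Void [0,0,1,1,0], Void [0,0,1,2,0], Plane [-1,-3] 1], Flat [5,1,3] 1 [ Plane [-2,-5] 1,
    Void [0,0,1,2,0], Plane [2,3] 1, Plane [1,3] 1], Flat [4,1,6] 1 [ Void [0,0,0,1,0],
    Plane [-1,-5] 2, Void [0,0,2,1,0], Void [0,0,1,1,0], Void [0,1,0,1,0]], Flat [4,1,7] 1 [
    Plane [-1,-6] 2, Void [0,0,1,2,0], Void [0,1,0,2,0], Void [0,1,0,1,0]], Flat [4,1,8] 1 [
    Plane [-1,-7] 2, Void [0,0,2,3,0], Void [0,0,1,3,0], Void [0,1,0,3,0], Void [0,1,0,2,0],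
    Void [0,1,0,1,0]], Flat [4,1,2] 1 [ Plane [1,2] 1, Plane [3,2] 2, Plane [1,2] 1],
    Flat [2,1,4] 1 [ Plane [1,2] 1, Plane [2,1] 1, Plane [1,3] 1], Flat [5,1,2] 1 [ Plane [1,3] 1],
    Flat [5,2,4] 1 [ Plane [1,5] 1], Flat [2,1,4] 1 [ Void [0,0,0,1,0]], Flat [5,2,1] 1 [],
    Flat [7,1,3] 1 []], Flat [4,5,1,2] 1 [ Void [0,0,0,1,0], Flat [6,1,3] 1 [ Void [1,0,0,0,0],
    Void [0,1,0,0,1], Void [0,1,1,0,1], Void [0,1,1,1,0], Void [0,1,1,2,0], Void [1,0,0,1,0],
    Plane [1,2] 1, Plane [2,1] 1, Void [0,2,0,0,1], Void [0,1,0,2,0], Plane [5,1] 1],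
    Flat [5,2,1] 1 [ Void [0,1,0,1,0], Void [0,1,1,1,0], Void [0,1,1,2,0], Void [1,0,0,0,0],
    Void [1,0,0,0,1], Plane [1,2] 1, Plane [2,1] 1, Void [0,2,0,1,0], Plane [3,1] 1,
    Plane [4,1] 1], Flat [4,1,2] 1 [ Void [0,0,1,0,1], Void [0,0,1,1,0], Void [0,0,2,0,1],
    Void [0,0,2,1,0], Plane [2,1] 1, Plane [4,1] 2, Plane [1,5] 2, Plane [1,4] 1, Plane [3,1] 1],
    Void [0,1,0,0,1], Void [0,1,0,0,0], Void [0,1,0,1,0], Void [0,1,1,0,1], Void [0,1,1,1,0],
    Void [0,1,1,2,0], Flat [4,1,2] 1 [ Plane [1,3] 1, Plane [1,6] 2, Plane [2,1] 1, Plane [3,1] 1],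
    Flat [2,3,1] 1 [ Void [0,0,1,0,1], Void [0,0,1,1,0], Void [0,0,2,0,1], Plane [2,1] 1,
    Plane [1,3] 1, Plane [3,1] 1], Flat [5,1,2] 1 [ Plane [4,1] 1, Plane [1,4] 1], Flat [5,2,1] 1 [
    Plane [3,2] 1], Flat [1,4,2] 1 [ Plane [2,3] 1, Plane [3,4] 1], Flat [3,1,6] 1 [
    Plane [1,5] 1], Flat [6,2,1] 1 [ Plane [5,1] 1], Flat [5,1,3] 1 [], Flat [3,6,1] 1 []],
    Flat [2,6,4,1] 1 [ Flat [5,2,1] 1 [ Void [0,0,0,1,1], Plane [3,1] 1, Plane [2,1] 1,
    Plane [6,1] 2, Plane [5,1] 2, Void [0,1,1,0,0], Void [0,0,0,0,1], Void [0,0,0,1,2],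
    Plane [2,1] 1, Plane [4,1] 2], Flat [4,2,1] 1 [ Void [0,0,0,0,1], Void [0,0,1,0,0],
    Plane [2,1] 1, Void [0,1,1,0,0], Plane [3,1] 1, Plane [3,1] 1, Plane [2,1] 1], Flat [2,3,1] 1 [
    Void [0,0,1,0,1], Void [0,0,1,0,0], Void [0,0,2,0,1], Void [0,1,1,0,0], Plane [3,2] 2,
    Plane [2,1] 1, Plane [2,1] 1], Flat [5,3,1] 1 [ Void [0,0,0,0,1], Plane [-4,-1] 1,
    Void [0,0,1,0,2], Plane [4,1] 1, Plane [3,1] 1], Flat [4,2,1] 1 [ Void [0,0,1,0,1],
    Plane [-2,-1] 1], Void [0,1,0,0,0], Flat [2,6,1] 1 [ Void [0,0,0,0,1], Plane [-5,-1] 2,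
    Void [0,0,1,0,2], Void [0,1,0,0,1], Void [0,1,0,0,2]], Flat [2,5,1] 1 [ Plane [-4,-1] 2,
    Void [0,0,2,0,1], Void [0,0,1,0,1], Void [0,1,0,0,1]], Void [0,1,1,0,0], Flat [2,6,1] 1 [
    Void [0,0,0,1,1], Plane [2,1] 1, Plane [5,1] 2], Flat [2,3,1] 1 [ Void [0,0,1,0,0],
    Plane [2,1] 1, Plane [2,1] 1], Flat [5,2,1] 1 [ Plane [3,1] 1], Flat [4,5,1] 1 [],
    Flat [2,4,1] 1 [ Void [0,0,0,0,1]], Flat [2,4,1] 1 []], Flat [2,3,7,4] 1 [ Void [0,0,0,1,0],
    Void [0,0,0,1,1], Flat [2,3,4] 1 [ Void [0,0,0,0,1], Plane [2,3] 1, Plane [2,3] 1,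
    Plane [2,3] 1, Void [1,0,0,0,0], Void [1,0,0,1,0], Void [1,0,0,1,1], Void [1,0,0,0,1],
    Plane [3,1] 1, Plane [3,4] 1, Plane [3,7] 1], Flat [4,2,3] 1 [ Void [0,0,1,0,1],
    Void [0,0,1,1,0], Void [0,0,1,2,0], Void [1,0,0,0,0], Void [1,0,0,1,0], Void [1,0,1,0,0],
    Void [0,1,0,0,1], Void [0,1,0,2,0], Plane [3,2] 1], Flat [2,4,3] 1 [ Plane [2,-3] 1,
    Void [0,0,0,0,1], Void [1,0,0,0,0], Void [1,0,0,1,0], Void [1,0,0,1,1], Plane [1,3] 1,
    Plane [4,3] 1], Flat [2,3,2] 1 [ Void [0,0,0,0,1], Plane [4,3] 2, Plane [4,3] 2,
    Void [1,0,0,0,0], Void [1,0,0,1,0], Void [1,0,0,1,1], Void [1,0,1,0,0], Void [1,0,1,0,1],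
    Plane [6,1] 2, Void [1,0,0,0,1], Plane [3,2] 1, Plane [3,5] 1, Plane [4,3] 2], Flat [3,3,1] 1 [
    Void [1,0,0,0,0], Void [1,0,0,1,0], Void [1,0,0,1,1], Plane [1,2] 1, Void [1,0,1,0,0],
    Plane [2,1] 1, Plane [1,9] 2, Plane [3,1] 1], Flat [2,2,3] 1 [ Void [1,0,0,0,0],
    Void [1,0,0,1,0], Void [1,0,0,1,1], Plane [1,6] 2, Void [1,0,1,1,0], Void [1,0,1,0,0],
    Plane [2,3] 1], Flat [2,2,5] 1 [ Void [1,0,0,0,0], Void [1,0,0,1,0], Void [1,0,0,1,1],
    Plane [1,7] 2, Void [1,0,1,2,0], Void [1,0,1,1,0], Plane [2,5] 1, Void [1,0,0,2,0],
    Void [0,0,1,0,0]], Void [1,0,0,0,0], Void [1,0,0,1,0], Void [1,0,0,1,1], Flat [4,3,2] 1 [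
    Void [0,0,0,0,1], Plane [3,2] 1, Plane [1,4] 1, Plane [2,7] 1], Flat [6,1,3] 1 [
    Void [0,0,1,0,1], Void [0,0,1,1,0], Void [0,0,1,2,0], Void [1,0,0,2,0], Plane [5,1] 1],
    Flat [4,2,3] 1 [ Plane [4,1] 1, Void [0,0,1,0,0]], Flat [3,5,4] 1 [ Void [0,0,0,0,1],
    Plane [3,4] 1, Plane [3,4] 1, Plane [4,7] 1], Flat [4,2,5] 1 [ Plane [1,6] 1, Plane [5,3] 1],
    Flat [3,4,5] 1 [], Flat [4,2,7] 1 [ Void [0,1,1,0,0]], Flat [2,4,7] 1 [], Flat [2,3,4] 1 []],
    Flat [6,4,3,2] 1 [ Void [0,0,0,0,1], Void [0,0,1,0,0], Flat [4,3,2] 1 [ Void [0,0,0,1,1],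
    Void [0,0,0,2,1], Void [1,0,0,0,0], Void [1,0,0,0,1], Plane [4,1] 1, Void [0,1,0,1,0],
    Plane [3,-2] 1], Flat [4,3,5] 1 [ Plane [3,-2] 1, Void [1,0,0,0,0], Void [1,0,0,0,1],
    Void [1,0,0,1,0], Plane [4,5] 1, Plane [2,5] 1], Flat [4,1,3] 1 [ Void [1,0,0,0,0],
    Void [1,0,0,0,1], Void [1,0,1,0,0], Plane [3,4] 2, Plane [1,8] 2, Void [0,0,1,1,0],
    Plane [5,1] 1], Flat [8,3,7] 2 [ Void [1,0,0,0,0], Void [1,0,0,0,1], Void [1,0,1,1,0],
    Void [1,0,1,0,0], Plane [2,3] 1, Void [1,0,0,1,0], Plane [3,-1] 1, Void [0,0,1,2,0]],
    Flat [8,3,10] 2 [ Void [1,0,0,0,0], Void [1,0,0,0,1], Void [1,0,1,2,0], Void [1,0,1,1,0],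
    Plane [2,5] 1, Void [1,0,0,2,0], Void [1,0,0,1,0], Plane [3,-1] 1, Void [0,0,1,3,0],
    Void [0,0,2,0,1]], Void [1,0,0,0,0], Void [1,0,0,0,1], Flat [4,2,3] 1 [ Void [0,0,1,0,1],
    Void [0,0,1,1,0], Void [0,0,1,2,0], Plane [3,1] 1, Plane [4,1] 1], Flat [3,2,4] 1 [
    Plane [4,3] 1, Plane [2,3] 1, Plane [1,3] 1], Flat [1,5,3] 1 [ Plane [2,3] 1, Plane [2,3] 1],
    Flat [2,4,3] 1 [ Plane [2,3] 1], Flat [1,5,3] 1 [ Plane [2,5] 1, Void [0,1,0,1,0]],
    Flat [4,1,7] 1 [ Plane [2,7] 1, Void [0,1,0,2,0], Void [0,1,1,0,0]], Flat [5,3,4] 1 [],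
    Flat [5,3,1] 1 [ Plane [5,2] 1], Flat [4,6,1] 1 []], Flat [6,3,4,1] 1 [ Void [0,0,1,0,1],
    Void [0,0,1,0,0], Void [0,0,1,1,0], Void [0,0,2,0,1], Void [0,0,2,1,0], Void [1,0,0,0,0],
    Flat [1,4,2] 1 [ Plane [3,1] 1, Plane [2,3] 1, Plane [1,4] 1, Plane [2,1] 1], Flat [1,6,2] 1 [
    Plane [1,3] 1, Plane [1,3] 1, Void [0,1,0,0,1], Plane [5,1] 1, Plane [4,5] 1], Flat [1,4,3] 1 [
    Void [0,0,0,1,0], Plane [3,4] 1, Plane [1,3] 1], Flat [1,4,3] 1 [ Plane [1,5] 1,
    Void [0,1,0,1,0]], Flat [1,2,7] 1 [ Plane [1,7] 1, Void [0,1,0,2,0], Void [0,1,0,1,0],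
    Void [0,1,1,0,0]], Flat [6,2,3] 1 [ Plane [5,2] 1, Plane [7,2] 1], Flat [6,1,3] 1 [
    Void [0,0,0,1,0], Plane [7,2] 1], Flat [6,3,2] 1 [], Flat [6,1,4] 1 [], Flat [6,3,2] 1 []],
    Flat [2,4,3,5] 1 [ Void [0,0,0,0,1], Flat [1,4,3] 1 [ Plane [2,3] 1, Void [1,0,1,0,0],
    Void [1,0,1,0,1], Void [1,0,0,0,0], Void [1,0,0,0,1], Plane [4,3] 1, Plane [2,3] 1],
    Flat [3,4,2] 1 [ Void [0,0,0,1,0], Plane [3,2] 1, Void [1,0,0,0,1], Void [1,0,0,0,2],
    Void [1,0,0,0,0], Void [0,1,0,1,0]], Flat [3,4,6] 1 [ Plane [3,5] 1, Void [1,0,1,0,0],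
    Void [1,0,1,0,1], Void [1,0,0,0,0], Void [1,0,0,0,1], Void [1,0,0,1,0]], Flat [2,3,10] 1 [
    Plane [3,8] 1, Void [1,0,1,0,0], Void [1,0,1,0,1], Void [1,0,0,0,0], Void [1,0,0,0,1],
    Void [1,0,1,1,0], Void [1,0,0,2,0], Void [1,0,0,1,0]], Flat [2,5,1] 1 [ Void [0,0,0,1,0],
    Void [0,0,0,1,1], Void [1,0,0,0,1], Plane [2,1] 1, Plane [2,1] 1, Plane [3,7] 2],
    Void [1,0,1,0,0], Void [1,0,1,0,1], Void [1,0,0,0,0], Void [1,0,0,0,1], Flat [4,3,2] 1 [
    Plane [3,1] 1], Flat [5,3,4] 1 [ Void [0,0,0,1,0]], Flat [2,4,5] 1 [ Void [0,1,0,1,0]],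
    Flat [4,3,8] 1 [ Void [0,1,0,2,0]], Flat [3,4,2] 1 []], Flat [5,3,4,2] 1 [ Void [0,0,0,1,0],
    Void [0,0,1,0,1], Void [0,0,1,1,0], Void [0,0,1,2,0], Flat [3,4,1] 1 [ Void [0,0,0,1,1],
    Plane [4,1] 2, Plane [3,5] 2, Plane [1,4] 1, Plane [3,2] 1], Flat [3,2,4] 1 [ Plane [1,6] 2,
    Plane [2,3] 1, Plane [1,3] 1], Void [1,0,1,0,0], Void [1,0,0,0,0], Flat [1,5,2] 1 [
    Plane [1,3] 1, Plane [3,4] 1], Flat [3,2,6] 1 [ Plane [1,6] 1], Flat [4,3,2] 1 [
    Plane [5,2] 1], Flat [5,3,4] 1 [], Flat [3,5,2] 1 []], Flat [2,4,5,3] 1 [ Flat [3,6,4] 1 [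
    Void [0,0,0,0,1], Plane [5,3] 1, Void [1,0,2,0,0], Void [1,0,1,1,0], Void [1,0,1,0,0],
    Void [1,0,0,1,0], Void [1,0,0,0,0], Void [1,0,0,0,1]], Flat [2,4,3] 1 [ Plane [2,3] 1,
    Plane [2,5] 1, Void [1,0,0,2,0], Void [1,0,0,1,0], Void [1,0,0,0,0]], Void [0,0,1,0,0],
    Flat [2,6,3] 1 [ Void [0,0,0,1,1], Void [1,0,0,1,0], Plane [4,3] 2, Plane [1,2] 1],
    Flat [1,3,6] 1 [ Void [0,0,0,0,1], Plane [1,6] 2, Void [1,0,0,2,0]], Void [1,0,1,1,0],
    Flat [4,2,3] 1 [ Void [0,0,0,0,1], Plane [1,3] 1], Void [1,0,0,1,0], Void [1,0,0,0,0],
    Flat [2,5,4] 1 [ Void [0,0,0,0,1], Void [0,1,0,0,1]], Flat [5,4,3] 1 [], Flat [3,2,4] 1 []],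
    Flat [4,2,7,3] 1 [ Void [0,0,0,0,1], Flat [3,2,6] 1 [ Plane [2,5] 1, Void [1,0,2,0,0],
    Void [1,0,2,0,1], Void [1,0,1,0,0], Void [1,0,1,0,1], Void [1,0,0,0,0], Void [1,0,0,0,1],
    Void [1,1,0,0,0], Void [1,1,0,0,1]], Flat [3,2,6] 1 [ Plane [2,5] 1, Void [1,0,2,0,0],
    Void [1,0,2,0,1], Void [1,0,1,0,0], Void [1,0,1,0,1], Void [1,0,1,1,0], Void [1,0,0,0,0],
    Void [1,0,0,0,1], Void [1,0,0,1,0], Void [1,1,0,0,0], Void [1,1,0,0,1], Void [1,1,0,1,0]],
    Flat [2,7,1] 1 [ Void [0,0,0,1,0], Void [0,0,0,1,1], Void [1,0,0,1,0], Void [1,0,1,0,1],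
    Plane [5,1] 1, Void [1,0,0,0,1], Plane [5,2] 2, Plane [5,7] 2, Plane [5,6] 1],
    Void [1,0,2,0,0], Void [1,0,2,0,1], Void [1,0,1,0,0], Void [1,0,1,0,1], Flat [2,6,3] 1 [
    Void [1,0,0,0,1], Void [1,0,0,0,2]], Void [1,0,0,0,0], Void [1,0,0,0,1], Flat [1,6,4] 1 [
    Void [1,1,0,0,0], Void [0,1,0,1,0], Void [0,1,0,0,0]], Flat [1,6,10] 1 [ Void [1,1,0,0,0],
    Void [0,1,0,2,0], Void [0,1,0,1,0], Void [0,1,0,0,0]], Void [1,1,0,0,0], Void [1,1,0,0,1],
    Flat [3,6,1] 1 [], Flat [3,6,7] 1 []], Flat [4,3,6,2] 1 [ Void [0,0,0,1,0], Flat [3,5,2] 1 [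
    Void [0,0,0,1,1], Void [1,0,1,0,0], Plane [1,7] 2, Plane [2,5] 1, Plane [3,4] 1],
    Flat [3,2,7] 1 [ Plane [3,4] 1, Plane [1,8] 2, Void [1,1,0,0,0], Plane [1,4] 1],
    Void [1,0,2,0,0], Flat [4,2,5] 1 [ Plane [2,3] 1, Plane [1,6] 1, Void [1,0,0,1,0]],
    Void [1,0,1,0,0], Flat [4,5,2] 1 [ Void [1,0,0,0,1]], Void [1,0,0,0,0], Flat [3,1,9] 1 [
    Void [1,1,0,0,0], Void [0,1,0,0,0]], Void [1,1,0,0,0], Flat [3,2,7] 1 [], Flat [2,5,4] 1 []],
    Flat [2,4,5,7] 1 [ Flat [2,6,5] 1 [ Void [0,0,0,1,1], Plane [2,5] 1, Void [1,0,1,1,0],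
    Void [1,0,0,0,1], Plane [4,5] 2, Void [1,0,0,1,0]], Flat [1,3,7] 1 [ Void [0,0,0,0,1],
    Void [1,1,0,0,0], Plane [2,7] 1, Void [1,1,0,1,0]], Void [1,0,2,1,0], Flat [2,3,6] 1 [
    Void [0,0,0,0,1], Void [1,0,0,1,0], Void [1,0,0,2,0]], Void [1,0,1,1,0], Void [1,0,1,0,0],
    Flat [2,5,6] 1 [ Void [0,0,0,0,1], Void [0,1,0,0,0], Void [0,1,0,0,1], Void [1,1,0,0,0]],
    Void [1,0,0,1,0], Void [1,0,0,0,0], Flat [4,1,8] 1 [ Void [0,0,0,0,1]], Void [1,1,0,1,0],
    Void [1,1,0,0,0]], Flat [3,5,2,11] 1 [ Flat [3,2,9] 1 [ Void [0,0,0,1,1], Plane [2,7] 1,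
    Void [1,0,1,2,0], Void [1,0,0,1,1], Plane [4,9] 2, Void [1,0,0,2,0], Void [1,0,0,1,0],
    Void [1,0,1,0,0], Void [1,0,2,0,0]], Flat [1,3,10] 1 [ Void [0,0,0,0,1], Void [0,0,1,0,0],
    Void [1,1,0,1,0], Void [1,0,0,0,1], Void [1,0,0,2,0], Plane [2,9] 1, Void [1,1,0,2,0],
    Void [1,1,1,0,0]], Void [1,0,2,2,0], Flat [4,1,8] 1 [ Void [0,0,0,0,1], Void [1,0,1,0,1],
    Void [1,0,0,2,0], Void [1,0,0,1,0], Void [1,0,0,3,0]], Void [1,0,1,2,0], Void [1,0,1,1,0],
    Flat [2,5,11] 1 [ Void [0,0,0,0,1], Void [1,0,0,0,1], Void [0,1,0,0,0], Void [0,1,0,0,1],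
    Void [1,1,0,1,0], Void [1,1,0,0,0]], Void [1,0,0,2,0], Void [1,0,0,1,0], Void [1,0,0,0,0],
    Flat [4,1,9] 1 [ Void [0,0,0,0,1], Void [1,1,0,0,1]], Void [1,1,0,2,0], Void [1,1,0,1,0],
    Void [1,1,0,0,0], Void [1,1,1,0,0]], Flat [2,5,1,3] 1 [ Void [0,0,0,1,0], Void [0,0,0,1,1],
    Flat [1,3,2] 1 [ Void [0,0,0,0,1], Plane [1,2] 1, Plane [1,2] 1, Plane [1,2] 1],
    Flat [4,2,1] 1 [ Void [0,0,1,0,1], Void [0,0,1,1,0], Void [0,0,1,2,0], Plane [1,2] 1],
    Flat [1,2,3] 1 [ Plane [1,-2] 1, Void [0,0,0,0,1]], Flat [1,3,1] 1 [ Void [0,0,0,0,1],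
    Plane [1,1] 1, Plane [1,1] 1, Plane [1,1] 1], Flat [8,5,1] 2 [ Plane [14,1] 2],
    Flat [3,3,1] 1 [], Flat [1,1,4] 1 [ Void [0,0,1,0,0]], Flat [3,1,5] 1 [], Flat [3,4,1] 1 []],
    Flat [1,4,2,3] 1 [ Void [0,0,0,0,1], Void [0,0,1,0,0], Flat [2,3,1] 1 [ Void [0,1,0,0,0],
    Void [0,1,0,1,0], Plane [1,-2] 1], Flat [2,1,4] 1 [ Plane [5,-1] 1], Flat [2,3,4] 2 [
    Void [0,1,0,0,0], Plane [14,1] 2], Flat [4,3,5] 2 [ Plane [12,-1] 2, Void [0,1,0,1,0]],
    Flat [4,3,8] 2 [ Plane [14,-1] 2, Void [0,1,0,2,0], Void [0,1,1,0,0]], Flat [1,3,2] 1 [],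
    Flat [2,1,3] 1 [ Plane [1,2] 1], Flat [1,3,2] 1 []], Flat [3,1,4,2] 1 [ Void [0,0,1,0,1],
    Void [0,0,1,0,0], Void [0,0,1,1,0], Void [0,0,2,0,1], Void [0,0,2,1,0], Flat [1,2,3] 1 [
    Plane [1,2] 1, Plane [7,1] 1], Flat [4,2,1] 1 [ Void [0,0,0,1,0], Plane [5,1] 1],
    Flat [2,3,1] 1 [], Flat [4,2,3] 1 [], Flat [1,3,2] 1 []], Flat [1,5,2,4] 1 [ Void [0,0,0,0,1],
    Flat [3,5,1] 1 [ Plane [1,2] 1], Flat [1,3,2] 1 [ Void [0,0,0,1,0]], Flat [2,1,5] 1 [],
    Flat [2,3,7] 1 [], Flat [2,1,4] 1 []], Flat [1,4,3,2] 1 [ Void [0,0,0,1,0], Void [0,0,1,0,1],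
    Void [0,0,1,1,0], Void [0,0,1,2,0], Flat [1,2,3] 1 [ Plane [6,1] 1], Flat [2,1,4] 1 [],
    Flat [3,6,1] 1 []], Flat [1,5,4,2] 1 [ Flat [2,5,1] 1 [ Void [0,0,0,0,1]], Flat [2,4,1] 1 [],
    Void [0,0,1,0,0], Flat [2,4,1] 1 []], Flat [1,2,6,3] 1 [ Void [0,0,0,0,1], Flat [1,2,5] 1 [
    Void [0,1,0,0,0], Void [0,1,0,0,1]], Flat [5,1,3] 1 [ Void [0,1,0,0,0], Void [0,1,0,0,1],
    Void [0,1,0,1,0]], Void [0,1,0,0,0], Void [0,1,0,0,1], Flat [1,5,2] 1 [], Flat [1,5,7] 1 []],
    Flat [2,4,6,1] 1 [ Void [0,0,0,1,0], Void [0,1,0,0,0], Flat [1,3,5] 1 [], Flat [1,6,4] 1 []],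
    Flat [4,2,6,3] 1 [ Flat [2,4,5] 1 [ Void [0,0,0,0,1]], Void [0,1,0,1,0], Void [0,1,0,0,0]],
    Flat [3,5,2,8] 1 [ Flat [8,1,5] 1 [ Void [0,0,0,0,1], Void [0,1,0,0,1]], Void [0,1,0,2,0],
    Void [0,1,0,1,0], Void [0,1,0,0,0], Void [0,1,1,0,0]], Flat [1,2,4,5] 1 [ Void [0,0,0,0,1],
    Flat [4,5,1] 1 [], Flat [5,6,1] 1 []], Flat [1,6,3,2] 1 [ Void [0,0,0,1,0], Flat [5,6,1] 1 []],
    Flat [2,6,3,1] 1 [], Flat [2,7,1,4] 1 [ Void [0,0,1,0,0]], Flat [1,8,3,2] 1 []]"

text \<open>At the root the flat is the whole space: the parameters are the gaps themselves, and no
  relation is yet assumed to fail.\<close>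

lemma check_certificate: "check certificate relations [] gaps"
  by code_simp

section \<open>From relations between gaps to equalities of letter sums\<close>

lemma relation_in_relations:
  "i < k \<Longrightarrow> k \<le> l \<Longrightarrow> l < j \<Longrightarrow> j < 6 \<Longrightarrow> relation i k l j \<in> set relations"
proof -
  assume "i < k" "k \<le> l" "l < j" "j < 6"
  then have "relation i k l j \<in> (\<Union>i\<in>{0..<6}. \<Union>k\<in>{Suc i..<6}. \<Union>l\<in>{k..<6}. relation i k l ` {Suc l..<6})"
    by (intro UN_I[of i] UN_I[of k] UN_I[of l] imageI) auto
  then show ?thesis by (simp add: relations_def)
qed

lemma dot_map_upt:
  fixes f g :: "nat \<Rightarrow> 'a :: comm_ring_1"
  shows "dot (map f [0..<n]) (map g [0..<n]) = (\<Sum>m<n. f m * g m)"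
proof -
  have "dot (xs @ [a]) (ys @ [b]) = dot xs ys + a * b" if "length xs = length ys" for xs ys and a b :: 'a
    using that by (induction xs ys rule: list_induct2) (auto simp: algebra_simps)
  then show ?thesis by (induction n) auto
qed

text \<open>The two blocks of coefficients 1 and -1 each telescope to a difference of letters.
  Stated over any commutative ring, since it is applied to the real letters and to the scaled
  integer ones.\<close>

lemma dot_relation:
  fixes t :: "nat \<Rightarrow> 'a :: comm_ring_1"
  assumes "i < k" "k \<le> l" "l < j" "j < 6"
  shows "dot (map of_int (relation i k l j)) (map (\<lambda>n. t (Suc n) - t n) [0..<5]) = t k - t i - (t j - t l)"
proof -
  have gap: "(\<Sum>m<5. of_bool (a \<le> m \<and> m < b) * (t (Suc m) - t m)) = t b - t a"
    if "a \<le> b" "b < 6" for a b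
  proof -
    have "(\<Sum>m<5. of_bool (a \<le> m \<and> m < b) * (t (Suc m) - t m)) = (\<Sum>m=a..<b. t (Suc m) - t m)"
      using that by (subst sum_of_bool_mult_eq) (auto intro!: sum.cong)
    then show ?thesis using that by (simp add: sum_Suc_diff')
  qed
  have "dot (map of_int (relation i k l j)) (map (\<lambda>n. t (Suc n) - t n) [0..<5]) =
      (\<Sum>m<5. (of_bool (i \<le> m \<and> m < k) - of_bool (l \<le> m \<and> m < j)) * (t (Suc m) - t m))"
    unfolding relation_def map_map dot_map_upt using assms by (intro sum.cong) auto
  also have "\<dots> = t k - t i - (t j - t l)"
    using gap[of i k] gap[of l j] assms by (simp add: left_diff_distrib sum_subtractf)
  finally show ?thesis .
qed

text \<open>By symmetry each pair is sorted and \<open>i\<close> is the smaller of the two least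
  indices. If \<open>i = k\<close>, cancellation leaves \<open>j\<close> against \<open>l\<close>;
  if \<open>i < k\<close> and \<open>l < j\<close>, the pairs are nested and the equality is a
  relation.\<close>

lemma pair_sums_iff:
  fixes t :: "nat \<Rightarrow> real" and s :: "nat \<Rightarrow> int"
  assumes t: "\<And>i j. i < j \<Longrightarrow> j < m \<Longrightarrow> t i < t j" and s: "\<And>i j. i < j \<Longrightarrow> j < m \<Longrightarrow> s i < s j"
    and rel: "\<And>i k l j. i < k \<Longrightarrow> k \<le> l \<Longrightarrow> l < j \<Longrightarrow> j < m \<Longrightarrow>
      t k - t i - (t j - t l) = 0 \<longleftrightarrow> s k - s i - (s j - s l) = 0"
    and lt: "i < m" "j < m" "k < m" "l < m"
  shows "t i + t j = t k + t l \<longleftrightarrow> s i + s j = s k + s l"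
proof -
  have ti: "t a = t b \<longleftrightarrow> a = b" and si: "s a = s b \<longleftrightarrow> a = b" if "a < m" "b < m" for a b
    using t[of a b] t[of b a] s[of a b] s[of b a] that by (metis less_irrefl nat_neq_iff)+
  have nested: "t i + t j = t k + t l \<longleftrightarrow> s i + s j = s k + s l"
    if "i \<le> j" "k \<le> l" "i \<le> k" "i < m" "j < m" "k < m" "l < m" for i j k l
  proof (cases "i = k")
    case True
    then show ?thesis using ti[of j l] si[of j l] that by simp
  next
    case False
    then have ik: "i < k" using that by simp
    show ?thesis
    proof (cases "l < j")
      case True
      have "t i + t j = t k + t l \<longleftrightarrow> t k - t i - (t j - t l) = 0" by linarith
      also have "\<dots> \<longleftrightarrow> s k - s i - (s j - s l) = 0" using rel[OF ik _ True] that by blast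
      also have "\<dots> \<longleftrightarrow> s i + s j = s k + s l" by linarith
      finally show ?thesis .
    next
      case False
      \<comment> \<open>Without nesting one pair dominates the other termwise, strictly in one
        place, so equality fails on both sides.\<close>
      have "t i < t k" "s i < s k" using t s ik that by blast+
      moreover have "t j \<le> t l" "s j \<le> s l"
        using t[of j l] s[of j l] False that by (cases "j = l"; simp)+
      ultimately show ?thesis by simp
    qed
  qed
  have ordered: "t i + t j = t k + t l \<longleftrightarrow> s i + s j = s k + s l"
    if "i \<le> j" "k \<le> l" "i < m" "j < m" "k < m" "l < m" for i j k l
    using nested[of i j k l] nested[of k l i j] that by (cases "i \<le> k") auto
  show ?thesis
    using ordered[of i j k l] ordered[of j i k l] ordered[of i j l k] ordered[of j i l k] lt
    by (cases "i \<le> j"; cases "k \<le> l") (auto simp: add.commute)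
qed

lemma order_preserving_model_2I:
  assumes "length S = length T" "sorted_wrt (<) T" "sorted_wrt (<) S"
    and "\<And>i k l j. i < k \<Longrightarrow> k \<le> l \<Longrightarrow> l < j \<Longrightarrow> j < length T \<Longrightarrow>
      T ! k - T ! i - (T ! j - T ! l) = 0 \<longleftrightarrow> S ! k - S ! i - (S ! j - S ! l) = 0"
  shows "order_preserving_model 2 T S"
proof -
  have T: "T ! i < T ! j" and S: "S ! i < S ! j" if "i < j" "j < length T" for i j
    using assms that by (auto intro: sorted_wrt_nth_less)
  note pairs = pair_sums_iff[of "length T" "(!) T" "(!) S", OF T S assms(4)]
  have "(\<Sum>i\<leftarrow>is. T ! i) = (\<Sum>j\<leftarrow>js. T ! j) \<longleftrightarrow> (\<Sum>i\<leftarrow>is. S ! i) = (\<Sum>j\<leftarrow>js. S ! j)"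
    if h: "1 \<le> h" "h \<le> 2" "length is = h" "length js = h"
      "set is \<subseteq> {..<length T}" "set js \<subseteq> {..<length T}" for h "is" js
  proof -
    consider "h = 1" | "h = 2" using h by linarith
    then show ?thesis
    proof cases
      case 1
      then obtain i j where "is = [i]" "js = [j]" using h by (auto simp: length_Suc_conv)
      \<comment> \<open>Single letters are compared through their doubles.\<close>
      then show ?thesis using pairs[of i i j j] h by simp
    next
      case 2
      then obtain i j k l where "is = [i, j]" "js = [k, l]"
        using h by (auto simp: length_Suc_conv numeral_2_eq_2)
      then show ?thesis using pairs[of i j k l] h by simp
    qed
  qed
  then show ?thesis using assms(1,3) unfolding order_preserving_model_def by blast
qed

section \<open>The upper bound\<close>

text \<open>The gap vector of \<open>T\<close> is positive, so the checked tree yields integer gaps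
  with the same relations. Dividing them by \<open>D\<close> and summing from 0 gives the
  model.\<close>

lemma model_diameter_le_24:
  assumes "ordered_alphabet 6 T"
  shows "\<exists>S. order_preserving_model 2 T S \<and> diameter S \<le> 24"
proof -
  have T: "length T = 6" "sorted_wrt (<) T" using assms by (auto simp: ordered_alphabet_def)
  define x where "x = map (\<lambda>n. T ! Suc n - T ! n) [0..<5]"
  have lx: "length x = 5" by (simp add: x_def)
  have T_less: "T ! n < T ! Suc n" if "n < 5" for n
    using sorted_wrt_nth_less[OF T(2), of n "Suc n"] T(1) that by simp
  have "has_model gaps (set relations \<union> set []) x"
  proof (rule check_sound(1)[OF check_certificate])
    show "\<forall>p\<in>set gaps. rdot p x > 0"
      using T_less[of 0] T_less[of 1] T_less[of 2] T_less[of 3] T_less[of 4]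
      by (simp add: gaps_def x_def upt_rec numeral_eq_Suc)
  qed (auto simp: gaps_def relations_def relation_def lx)
  then obtain y D where y: "length (y :: int list) = 5" "D > 0"
     "\<forall>p\<in>set gaps. dot p y > 0 \<and> D dvd dot p y" "(\<Sum>p\<leftarrow>gaps. dot p y) \<le> 24 * D"
     "\<forall>f\<in>set relations. rdot f x = 0 \<longleftrightarrow> dot f y = 0"
    unfolding has_model_def lx by auto
  obtain a b c d e where abcde: "y = [a, b, c, d, e]"
    using y(1) by (auto simp: length_Suc_conv numeral_eq_Suc)
  then have "D dvd a" "D dvd b" "D dvd c" "D dvd d" "D dvd e"
    using y(3) by (auto simp: gaps_def)
  then obtain a' b' c' d' e' where y': "a = D * a'" "b = D * b'" "c = D * c'" "d = D * d'" "e = D * e'"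
    unfolding dvd_def by blast
  have pos: "a' > 0" "b' > 0" "c' > 0" "d' > 0" "e' > 0"
    using y(2,3) by (auto simp: gaps_def abcde y' zero_less_mult_iff)
  define S where "S = [0, a', a' + b', a' + b' + c', a' + b' + c' + d', a' + b' + c' + d' + e']"
  \<comment> \<open>Written as the gaps of the scaled letters \<open>D * S ! n\<close>,
    \<open>y\<close> falls under \<open>dot_relation\<close>; the positive factor \<open>D\<close>
    cancels afterwards.\<close>
  have y_S: "y = map (\<lambda>n. D * S ! Suc n - D * S ! n) [0..<5]"
    by (simp add: abcde y' S_def upt_rec numeral_eq_Suc algebra_simps)
  have "order_preserving_model 2 T S"
  proof (rule order_preserving_model_2I)
    fix i k l j assume ord: "i < k" "k \<le> l" "l < j" "j < length T"
    then have lt: "j < 6" using T by simp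
    have "T ! k - T ! i - (T ! j - T ! l) = 0 \<longleftrightarrow> D * S ! k - D * S ! i - (D * S ! j - D * S ! l) = 0"
      using bspec[OF y(5) relation_in_relations[OF ord(1-3) lt]]
        dot_relation[OF ord(1-3) lt, of "\<lambda>n. T ! n"] dot_relation[OF ord(1-3) lt, of "\<lambda>n. D * S ! n"]
      unfolding x_def y_S by simp
    moreover have "D * S ! k - D * S ! i - (D * S ! j - D * S ! l) = D * (S ! k - S ! i - (S ! j - S ! l))"
      by (simp add: algebra_simps)
    ultimately show "T ! k - T ! i - (T ! j - T ! l) = 0 \<longleftrightarrow> S ! k - S ! i - (S ! j - S ! l) = 0"
      using y(2) by simp
  qed (use T pos in \<open>auto simp: S_def\<close>)
  moreover have "D * (a' + b' + c' + d' + e') \<le> D * 24"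
    using y(4) by (simp add: gaps_def abcde y' algebra_simps)
  then have "diameter S \<le> 24"
    using y(2) by (simp add: diameter_def S_def)
  ultimately show ?thesis by blast
qed

section \<open>The lower bound\<close>

lemma order_preserving_model_2D:
  assumes "order_preserving_model 2 T S"
    and "i < length T" "j < length T" "k < length T" "l < length T"
  shows "T ! i + T ! j = T ! k + T ! l \<longleftrightarrow> S ! i + S ! j = S ! k + S ! l"
proof -
  have "(\<Sum>i\<leftarrow>[i, j]. T ! i) = (\<Sum>j\<leftarrow>[k, l]. T ! j) \<longleftrightarrow> (\<Sum>i\<leftarrow>[i, j]. S ! i) = (\<Sum>j\<leftarrow>[k, l]. S ! j)"
    using assms unfolding order_preserving_model_def
    by (elim conjE allE[of _ 2] allE[of _ "[i, j]"] allE[of _ "[k, l]"]) auto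
  then show ?thesis by simp
qed

definition extremal_alphabet :: "real list" where
  "extremal_alphabet = [0, 6, 7, 12, 15, 24]"

text \<open>With \<open>g = e - d\<close> the equalities place the letters other than
  \<open>c\<close> at \<open>a\<close>, \<open>a + 2g\<close>, \<open>a + 4g\<close>,
  \<open>a + 5g\<close>, \<open>a + 8g\<close>. The letter \<open>c\<close> lies strictly between
  \<open>b\<close> and \<open>d\<close> and must avoid three midpoints, which leaves it no integer
  position for \<open>g = 1\<close> or \<open>g = 2\<close>.\<close>

lemma diameter_extremal_alphabet:
  assumes "order_preserving_model 2 extremal_alphabet S"
  shows "24 \<le> diameter S"
proof -
  have "length S = 6" and sorted: "sorted_wrt (<) S"
    using assms by (auto simp: order_preserving_model_def extremal_alphabet_def)
  then obtain a b c d e f where S: "S = [a, b, c, d, e, f]"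
    by (auto simp: length_Suc_conv numeral_eq_Suc)
  note iff = order_preserving_model_2D[OF assms, unfolded S extremal_alphabet_def]
  have eqs: "b + b = a + d" "d + d = a + f" "e + e = b + f"
    using iff[of 1 1 0 3] iff[of 3 3 0 5] iff[of 4 4 1 5] by (auto simp: numeral_eq_Suc)
  have neqs: "c + c \<noteq> b + d" "c + c \<noteq> a + e" "c + c \<noteq> b + e"
    using iff[of 2 2 1 3] iff[of 2 2 0 4] iff[of 2 2 1 4] by (auto simp: numeral_eq_Suc)
  have less: "a < b" "b < c" "c < d" "d < e" using sorted by (auto simp: S)
  have bd: "b = a + 2 * (e - d)" "d = a + 4 * (e - d)" and f: "f = a + 8 * (e - d)"
    using eqs by auto
  \<comment> \<open>For this value the only integer between \<open>b\<close> and \<open>d\<close> is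
    their midpoint.\<close>
  have "e - d \<noteq> 1"
    using neqs(1) less bd by auto
  moreover have "e - d \<noteq> 2"
  proof
    assume "e - d = 2"
    then have bd': "b = a + 4" "d = a + 8" "e = a + 10" using bd by auto
    \<comment> \<open>The three candidates are the midpoints of \<open>a\<close>, \<open>e\<close>,
      of \<open>b\<close>, \<open>d\<close> and of \<open>b\<close>, \<open>e\<close>, all excluded
      by \<open>neqs\<close>.\<close>
    then have "c = a + 5 \<or> c = a + 6 \<or> c = a + 7" using less(2,3) by presburger
    then show False using neqs bd' by auto
  qed
  ultimately have "e - d \<ge> 3" using less(4) by presburger
  then have "f - a \<ge> 24" using f by presburger
  then show ?thesis by (simp add: diameter_def S)
qed

theorem theorem3: "H 6 2 = 24"
  unfolding H_def
proof (rule Least_equality)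
  show "\<forall>T. ordered_alphabet 6 T \<longrightarrow> (\<exists>S. order_preserving_model 2 T S \<and> diameter S \<le> 24)"
    using model_diameter_le_24 by blast
next
  fix D :: int
  assume "\<forall>T. ordered_alphabet 6 T \<longrightarrow> (\<exists>S. order_preserving_model 2 T S \<and> diameter S \<le> D)"
  moreover have "ordered_alphabet 6 extremal_alphabet"
    by (simp add: ordered_alphabet_def extremal_alphabet_def)
  ultimately show "24 \<le> D" using diameter_extremal_alphabet by fastforce
qed

end
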